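(* Suppose that $\mu=\mathcal N(0,I_{d_y})$ on $\mathbb{R}^{d_y}$ and that $\nu=\mathcal N\big((0^\top,m_Y^\top)^\top,\Sigma\big)$ on $\mathbb{R}^{d_x+d_y}$ is the law of $(X,Y)$, where $m_Y:=\mathbb{E}[Y]$ and $\Sigma=\begin{pmatrix}\Sigma_{XX}&\Sigma_{XY}\\ \Sigma_{YX}&\Sigma_{YY}\end{pmatrix}$ is nonsingular. For $\varepsilon>0$ let $\pi^\varepsilon$ be the optimal coupling for the entropic vector quantile regression problem. As $\varepsilon\to0+$, we have $\pi^\varepsilon\to\pi^o$ weakly, where $\pi^o=\mathcal N(m,\Gamma_o)$ with $$m:=\begin{pmatrix}0\\ 0\\ m_Y\end{pmatrix},\quad \Gamma_o:=\begin{pmatrix}I_{d_y}&O&\Lambda_o\\ O&\Sigma_{XX}&\Sigma_{XY}\\ \Lambda_o&\Sigma_{YX}&\Sigma_{YY}\end{pmatrix},\quad \Lambda_o:=(\Sigma_{YY}-\Sigma_{YX}\Sigma_{XX}^{-1}\Sigma_{XY})^{1/2}.$$ The limiting law $\pi^o$ is optimal for the unregularized problem with the independence constraint, $$\inf_{\pi\in\Pi(\mu,\nu)}\big\{\mathbb{E}[\|U-\tilde Y\|^2]:(U,\tilde X,\tilde Y)\sim\pi,\ U\text{ and }\tilde X\text{ independent}\big\}.$$ For $(U,\tilde X,\tilde Y)\sim\pi^o$, one has $\tilde Y=m_Y+\Lambda_oU+\Sigma_{YX}\Sigma_{XX}^{-1}\tilde X$ almost surely.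
   Context: $\Pi(\mu,\nu)$ is the set of couplings of $\mu$ and $\nu$ (Borel probability measures on $\mathbb{R}^{d_y}\times\mathbb{R}^{d_x+d_y}$, points written $(u,x,y)$, with marginals $\mu,\nu$). For $\pi\in\Pi(\mu,\nu)$, $\pi_u$ is the conditional law of $(\tilde X,\tilde Y)$ given $U=u$ when $(U,\tilde X,\tilde Y)\sim\pi$. $\mathsf{KL}(P\|Q)=\int\log\frac{dP}{dQ}\,dP$ if $P\ll Q$ and $\infty$ otherwise. The entropic vector quantile regression problem is: minimize $\int\frac12\|u-y\|^2\,d\pi(u,x,y)+\varepsilon\,\mathsf{KL}(\pi\|\mu\otimes\nu)$ over $\pi\in\Pi(\mu,\nu)$ with $\int x\,d\pi_u(x,y)=0$ for $\mu$-a.e. $u$; it has a unique optimal solution $\pi^\varepsilon$. $O$ denotes a zero matrix; $A^{1/2}$ is the symmetric positive semidefinite square root. *)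

theory Defs
  imports "HOL-Probability.Probability"
begin

section \<open>Block vectors and block matrices\<close>

text \<open>On matrices (vectors of rows) \<open>vcat A B\<close> puts \<open>A\<close> on top of \<open>B\<close>; \<open>hcat A B\<close> puts them side by side.\<close>

definition vcat :: "'t^'a::finite \<Rightarrow> 't^'b::finite \<Rightarrow> 't^('a + 'b)" where
  "vcat v w = (\<chi> i. case i of Inl a \<Rightarrow> v $ a | Inr b \<Rightarrow> w $ b)"

definition hcat :: "'t^'c::finite^'a \<Rightarrow> 't^'d::finite^'a \<Rightarrow> 't^('c + 'd)^'a" where
  "hcat A B = (\<chi> i. vcat (A $ i) (B $ i))"

definition split_vec :: "'t^('a::finite + 'b::finite) \<Rightarrow> ('t^'a) \<times> ('t^'b)" where
  "split_vec v = ((\<chi> a. v $ Inl a), (\<chi> b. v $ Inr b))"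


section \<open>Normal distributions\<close>

definition psd :: "real^'n^'n \<Rightarrow> bool" where
  "psd A \<longleftrightarrow> transpose A = A \<and> (\<forall>v. 0 \<le> v \<bullet> (A *v v))"

definition psd_sqrt :: "real^'n^'n \<Rightarrow> real^'n^'n" where
  "psd_sqrt A = (THE B. psd B \<and> B ** B = A)"

definition std_gaussian :: "(real^'n) measure" where
  "std_gaussian = density lborel (\<lambda>z. ennreal (\<Prod>i\<in>UNIV. std_normal_density (z $ i)))"

text \<open>The law \<open>N(m, S)\<close>, meaningful for every positive semidefinite \<open>S\<close>, including singular
  ones, for which there is no density.\<close>

definition gaussian :: "real^'n \<Rightarrow> real^'n^'n \<Rightarrow> (real^'n) measure" where
  "gaussian m S = distr std_gaussian borel (\<lambda>z. m + psd_sqrt S *v z)"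


section \<open>Weak convergence and relative entropy\<close>

definition weakly_tendsto ::
    "('i \<Rightarrow> 'a::topological_space measure) \<Rightarrow> 'a measure \<Rightarrow> 'i filter \<Rightarrow> bool" where
  "weakly_tendsto Ms M F \<longleftrightarrow>
     (\<forall>f::'a \<Rightarrow> real. continuous_on UNIV f \<longrightarrow> bounded (range f) \<longrightarrow>
        ((\<lambda>i. \<integral>z. f z \<partial>Ms i) \<longlongrightarrow> (\<integral>z. f z \<partial>M)) F)"

text \<open>The library's \<open>KL_divergence b Q P\<close> takes the reference measure \<open>Q\<close> first and is
  real-valued. The negative part of \<open>ln (dP/dQ)\<close> is always \<open>P\<close>-integrable for probability measures,
  so a failure of integrability means that the integral is \<open>\<infinity>\<close>.\<close>

definition KL :: "'a measure \<Rightarrow> 'a measure \<Rightarrow> ereal" where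
  "KL P Q = (if absolutely_continuous Q P \<and> integrable P (entropy_density (exp 1) Q P)
             then ereal (KL_divergence (exp 1) Q P) else \<infinity>)"


section \<open>Couplings and vector quantile regression\<close>

definition couplings ::
    "'u::topological_space measure \<Rightarrow> 'v::topological_space measure \<Rightarrow> ('u \<times> 'v) measure set" where
  "couplings \<mu> \<nu> = {\<pi>. prob_space \<pi> \<and> sets \<pi> = sets borel \<and>
     distr \<pi> borel fst = \<mu> \<and> distr \<pi> borel snd = \<nu>}"

text \<open>\<open>K u\<close> is a version of the conditional law of the second component given that the first
  one is \<open>u\<close>; it is unique up to null sets of the first marginal.\<close>

definition cond_law ::
    "('u::topological_space \<times> 'v::topological_space) measure \<Rightarrow> ('u \<Rightarrow> 'v measure) \<Rightarrow> bool" where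
  "cond_law \<pi> K \<longleftrightarrow> K \<in> borel \<rightarrow>\<^sub>M prob_algebra borel \<and>
     (\<forall>A\<in>sets borel. \<forall>B\<in>sets borel.
        emeasure \<pi> (A \<times> B) = (\<integral>\<^sup>+u\<in>A. emeasure (K u) B \<partial>distr \<pi> borel fst))"

text \<open>The Bochner integral of a non-integrable function is \<open>0\<close>; \<open>has_bochner_integral\<close>
  rules that case out.\<close>

definition evqr_feasible ::
    "'u::euclidean_space measure \<Rightarrow> ('x::euclidean_space \<times> 'u) measure \<Rightarrow> ('u \<times> 'x \<times> 'u) measure set" where
  "evqr_feasible \<mu> \<nu> = {\<pi> \<in> couplings \<mu> \<nu>.
     \<exists>K. cond_law \<pi> K \<and> (AE u in \<mu>. has_bochner_integral (K u) (\<lambda>(x, y). x) 0)}"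

definition evqr_objective ::
    "real \<Rightarrow> 'u::euclidean_space measure \<Rightarrow> ('x::euclidean_space \<times> 'u) measure \<Rightarrow>
     ('u \<times> 'x \<times> 'u) measure \<Rightarrow> ereal" where
  "evqr_objective \<epsilon> \<mu> \<nu> \<pi> =
     enn2ereal (\<integral>\<^sup>+(u, x, y). ennreal (1/2 * (norm (u - y))\<^sup>2) \<partial>\<pi>) + ereal \<epsilon> * KL \<pi> (\<mu> \<Otimes>\<^sub>M \<nu>)"

text \<open>Independence of \<open>U\<close> and \<open>X\<close> is that of the sigma-algebras they generate; the library's
  \<open>indep_var\<close> requires both variables to have the same type.\<close>

definition indep_feasible ::
    "'u::euclidean_space measure \<Rightarrow> ('x::euclidean_space \<times> 'u) measure \<Rightarrow> ('u \<times> 'x \<times> 'u) measure set" where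
  "indep_feasible \<mu> \<nu> = {\<pi> \<in> couplings \<mu> \<nu>.
     prob_space.indep_set \<pi> (sets (vimage_algebra (space \<pi>) (\<lambda>(u, x, y). u) borel))
                           (sets (vimage_algebra (space \<pi>) (\<lambda>(u, x, y). x) borel))}"

end

theory Submission imports Defs begin

text \<open>
  Write \<open>R = \<Sigma>\<^sub>Y\<^sub>X \<Sigma>\<^sub>X\<^sub>X\<^sup>-\<^sup>1\<close> and let \<open>C\<close> be the Schur complement of \<open>\<Sigma>\<^sub>X\<^sub>X\<close>. Under \<open>\<nu>\<close> one has
  \<open>Y = m\<^sub>Y + R X + \<Lambda>\<^sub>o V\<close>, where \<open>V\<close> has the law \<open>\<mu>\<close> and is independent of \<open>X\<close>. The matrix \<open>\<Lambda>\<^sub>o = C\<^sup>1\<^sup>/\<^sup>2\<close> is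
  positive definite; let \<open>q w = w \<bullet> \<Lambda>\<^sub>o w\<close>. For a coupling of \<open>U\<close> and \<open>(X, Y)\<close>, expanding the square gives
  \<open>E|U - Y|\<^sup>2 = c - 2 E(U \<bullet> R X) + E q(U - V)\<close> with a constant \<open>c\<close> that depends on the marginals only. The
  middle term vanishes both when \<open>X\<close> has conditional mean zero given \<open>U\<close> and when \<open>X\<close> is independent
  of \<open>U\<close>. So under either constraint the cost is \<open>c + E q(U - V)\<close>, which is least when \<open>U = V\<close>
  (\<open>cost_eq\<close>). The law of \<open>(V, X, Y)\<close> under \<open>\<nu>\<close> satisfies both constraints, and it is \<open>\<pi>\<^sub>o\<close>: this gives
  the optimality of \<open>\<pi>\<^sub>o\<close> and the almost sure relation.

  For the weak convergence no formula for the entropic minimisers is needed. For every \<open>\<eta> > 0\<close> there is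
  a feasible coupling with \<open>E q(U - V) \<le> \<eta>\<close> and finite relative entropy (\<open>competitor\<close>): approximate the
  identity by a simple function \<open>s\<close> and let \<open>U\<close> and \<open>V\<close> be conditionally independent given a common
  value \<open>s U = s V\<close>. As relative entropy is
  nonnegative, comparing the minimiser with this coupling and letting \<open>\<epsilon>\<close> tend to \<open>0\<close> shows
  \<open>E q(U - V) \<rightarrow> 0\<close> along the minimisers. The law of \<open>(V, X, Y)\<close> is the same for all of them, so
  \<open>(U, X, Y)\<close> converges in law to \<open>(V, X, Y)\<close> (\<open>weakly_tendsto_pi0\<close>). None of this uses normality, and
  it is carried out for a linear model with general \<open>\<mu>\<close> and general law of \<open>X\<close>.

  The identification of \<open>\<nu>\<close> and \<open>\<pi>\<^sub>o\<close> rests on \<open>gaussian_matrix_factor\<close>: \<open>N(m, B B\<^sup>T)\<close> is the law of \<open>m + B z\<close>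
  for a standard normal \<open>z\<close>, also when \<open>B\<close> is singular, as is the case for \<open>\<pi>\<^sub>o\<close>. By the polar decomposition
  \<open>B\<close> agrees with the symmetric square root of \<open>B B\<^sup>T\<close> up to an orthogonal factor, and the standard normal
  law is invariant under orthogonal maps.
\<close>

section \<open>Square roots and polar decomposition of real matrices\<close>

lemma linear_coeff_zero_if_quadratic_nonneg:
  fixes b c :: real
  assumes "\<And>t. 0 \<le> t * b + t\<^sup>2 * c"
  shows "b = 0"
proof (rule ccontr)
  assume b: "b \<noteq> 0"
  define t where "t = - b / (\<bar>c\<bar> + 1)"
  have "t * b + t\<^sup>2 * c \<le> t * b + t\<^sup>2 * \<bar>c\<bar>"
    by (intro add_left_mono mult_left_mono) auto
  also have "\<dots> < t * b + t\<^sup>2 * (\<bar>c\<bar> + 1)"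
    using b by (intro add_strict_left_mono mult_strict_left_mono) (auto simp: t_def)
  also have "\<dots> = t * (b + t * (\<bar>c\<bar> + 1))"
    by (simp add: power2_eq_square algebra_simps)
  also have "\<dots> = 0"
    by (simp add: t_def)
  finally show False
    using assms[of t] by simp
qed

text \<open>The Rayleigh quotient \<open>x \<bullet> f x\<close> attains its maximum on the unit sphere of an invariant
  subspace, and a maximiser is an eigenvector.\<close>

lemma selfadjoint_eigenvector:
  fixes f :: "'a::euclidean_space \<Rightarrow> 'a"
  assumes lin: "linear f" and sa: "\<And>x y. f x \<bullet> y = x \<bullet> f y"
    and S: "subspace S" "f ` S \<subseteq> S" "S \<noteq> {0}"
  obtains e l where "e \<in> S" "norm e = 1" "f e = l *\<^sub>R e"
proof -
  obtain z where z: "z \<in> S" "z \<noteq> 0"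
    using S subspace_0 by blast
  have "compact (sphere 0 1 \<inter> S)"
    using S(1) by (intro compact_Int_closed closed_subspace) auto
  moreover have "sphere 0 1 \<inter> S \<noteq> {}"
  proof -
    have "z /\<^sub>R norm z \<in> sphere 0 1 \<inter> S"
      using z S(1) by (auto simp: subspace_mul)
    then show ?thesis by blast
  qed
  moreover have "continuous_on (sphere 0 1 \<inter> S) (\<lambda>x. x \<bullet> f x)"
    using lin by (intro continuous_intros linear_continuous_on) (simp add: linear_conv_bounded_linear)
  ultimately obtain e where e: "e \<in> S" "norm e = 1"
    and max: "\<And>x. x \<in> S \<Longrightarrow> norm x = 1 \<Longrightarrow> x \<bullet> f x \<le> e \<bullet> f e"
    using continuous_attains_sup[of "sphere 0 1 \<inter> S" "\<lambda>x. x \<bullet> f x"]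
    by (metis IntE IntI mem_sphere_0)
  define l where "l = e \<bullet> f e"
  have nonneg: "0 \<le> l * (x \<bullet> x) - x \<bullet> f x" if "x \<in> S" for x
  proof (cases "x = 0")
    case False
    have "(x /\<^sub>R norm x) \<bullet> f (x /\<^sub>R norm x) \<le> l"
      unfolding l_def using that False S(1) by (intro max) (auto simp: subspace_mul)
    then have "(x \<bullet> f x) / (norm x)\<^sup>2 \<le> l"
      using lin by (simp add: linear_cmul divide_inverse power2_eq_square mult_ac)
    then show ?thesis
      using False by (simp add: divide_le_eq power2_norm_eq_inner)
  qed (use lin in \<open>simp add: linear_0\<close>)
  have ortho: "(l *\<^sub>R e - f e) \<bullet> v = 0" if v: "v \<in> S" for v
  proof -
    have "0 \<le> t * (2 * ((l *\<^sub>R e - f e) \<bullet> v)) + t\<^sup>2 * (l * (v \<bullet> v) - v \<bullet> f v)" for t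
    proof -
      have "0 \<le> l * ((e + t *\<^sub>R v) \<bullet> (e + t *\<^sub>R v)) - (e + t *\<^sub>R v) \<bullet> f (e + t *\<^sub>R v)"
        using v e S(1) by (intro nonneg) (auto intro: subspace_add subspace_mul)
      also have "\<dots> = (l * (e \<bullet> e) - e \<bullet> f e) + t * (2 * l * (e \<bullet> v) - (e \<bullet> f v + v \<bullet> f e))
          + t\<^sup>2 * (l * (v \<bullet> v) - v \<bullet> f v)"
        using lin by (simp add: linear_add linear_cmul inner_add algebra_simps inner_commute power2_eq_square)
      also have "e \<bullet> f v = f e \<bullet> v"
        by (simp add: sa)
      also have "l * (e \<bullet> e) - e \<bullet> f e = 0"
        using e by (simp add: l_def flip: power2_norm_eq_inner)
      finally show ?thesis
        by (simp add: inner_diff inner_commute algebra_simps)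
    qed
    from linear_coeff_zero_if_quadratic_nonneg[OF this] show ?thesis
      by (simp add: algebra_simps)
  qed
  have "l *\<^sub>R e - f e \<in> S"
    using e S by (intro subspace_diff subspace_mul) auto
  from ortho[OF this] have "f e = l *\<^sub>R e" by simp
  then show thesis using that e by blast
qed

text \<open>By induction on the dimension, splitting off one eigenvector at a time.\<close>

lemma selfadjoint_eigenbasis:
  fixes f :: "'a::euclidean_space \<Rightarrow> 'a"
  assumes lin: "linear f" and sa: "\<And>x y. f x \<bullet> y = x \<bullet> f y"
    and S: "subspace S" "f ` S \<subseteq> S"
  shows "\<exists>B l. pairwise orthogonal B \<and> (\<forall>e\<in>B. norm e = 1 \<and> f e = l e *\<^sub>R e) \<and> span B = S"
  using S
proof (induction "dim S" arbitrary: S rule: less_induct)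
  case less
  show ?case
  proof (cases "S = {0}")
    case True
    then show ?thesis by (intro exI[of _ "{}"]) auto
  next
    case False
    obtain e l0 where e: "e \<in> S" "norm e = 1" "f e = l0 *\<^sub>R e"
      using selfadjoint_eigenvector[OF lin sa less.prems False] by metis
    have ee: "e \<bullet> e = 1"
      using e(2) by (simp flip: power2_norm_eq_inner)
    define S' where "S' = {x \<in> S. x \<bullet> e = 0}"
    have sub: "subspace S'"
      using less.prems(1) unfolding S'_def subspace_def by (auto simp: inner_add)
    have inv: "f ` S' \<subseteq> S'"
      using less.prems(2) e(3) by (auto simp: S'_def sa)
    have "e \<notin> S'" "S' \<subseteq> S"
      using ee by (auto simp: S'_def)
    with e(1) have "S' \<subset> S"
      by blast
    then have "dim S' < dim S"
      using sub less.prems(1) by (intro dim_psubset) (simp add: span_eq_iff[THEN iffD2])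
    from less.hyps[OF this sub inv] obtain B l where B: "pairwise orthogonal B"
      "\<And>b. b \<in> B \<Longrightarrow> norm b = 1 \<and> f b = l b *\<^sub>R b" "span B = S'"
      by blast
    have BS: "b \<bullet> e = 0" if "b \<in> B" for b
      using that B(3) span_base[of b B] by (auto simp: S'_def)
    have enB: "e \<notin> B"
      using BS ee by auto
    have "pairwise orthogonal (insert e B)"
      using B(1) BS by (auto simp: pairwise_insert orthogonal_def inner_commute)
    moreover have "\<forall>b\<in>insert e B. norm b = 1 \<and> f b = (l(e := l0)) b *\<^sub>R b"
      using B(2) e enB by auto
    moreover have "span (insert e B) = S"
    proof
      show "span (insert e B) \<subseteq> S"
        using e(1) B(3) span_superset[of B] less.prems(1)
        by (intro span_minimal) (auto simp: S'_def)
      show "S \<subseteq> span (insert e B)"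
      proof
        fix x assume x: "x \<in> S"
        have "x - (x \<bullet> e) *\<^sub>R e \<in> S'"
          using x e(1) less.prems(1) ee
          by (auto simp: S'_def inner_diff intro: subspace_diff subspace_mul)
        then show "x \<in> span (insert e B)"
          using B(3) by (auto simp: span_insert)
      qed
    qed
    ultimately show ?thesis by blast
  qed
qed

lemma transpose_inner:
  fixes A :: "real^'n^'m"
  shows "x \<bullet> (A *v y) = (transpose A *v x) \<bullet> y"
  by (simp add: dot_lmul_matrix transpose_matrix_vector)

lemma symmetric_eigenbasis:
  fixes A :: "real^'n^'n"
  assumes "transpose A = A"
  obtains B l where "pairwise orthogonal B" "\<And>e. e \<in> B \<Longrightarrow> norm e = 1"
    "\<And>e. e \<in> B \<Longrightarrow> A *v e = l e *\<^sub>R e" "span B = UNIV"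
proof -
  have "x \<bullet> (A *v y) = (A *v x) \<bullet> y" for x y
    using transpose_inner[of x A y] assms by simp
  then show thesis
    using selfadjoint_eigenbasis[of "(*v) A" UNIV] that by fastforce
qed

lemma matrix_eq_on_spanning:
  fixes A C :: "real^'n^'m"
  assumes "span B = UNIV" "\<And>e. e \<in> B \<Longrightarrow> A *v e = C *v e"
  shows "A = C"
  unfolding matrix_eq
  using linear_eq_on[of "(*v) A" "(*v) C" _ B] assms by fastforce

lemma psdD:
  assumes "psd A"
  shows "transpose A = A" "0 \<le> v \<bullet> (A *v v)" "x \<bullet> (A *v y) = (A *v x) \<bullet> y"
  using assms transpose_inner[of x A y] by (auto simp: psd_def)

lemma psd_sqrt_exists:
  fixes A :: "real^'n^'n"
  assumes A: "psd A"
  shows "\<exists>B. psd B \<and> B ** B = A"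
proof -
  obtain E l where E: "pairwise orthogonal E" "\<And>e. e \<in> E \<Longrightarrow> norm e = 1"
    "\<And>e. e \<in> E \<Longrightarrow> A *v e = l e *\<^sub>R e" "span E = UNIV"
    using symmetric_eigenbasis[OF psdD(1)[OF A]] by blast
  have fin: "finite E"
    using E(1) by (rule pairwise_orthogonal_imp_finite)
  have ee: "e \<bullet> e' = (if e = e' then 1 else 0)" if "e \<in> E" "e' \<in> E" for e e'
    using that E(1,2) by (auto simp: pairwise_def orthogonal_def simp flip: power2_norm_eq_inner)
  have l: "0 \<le> l e" if "e \<in> E" for e
    using psdD(2)[OF A, of e] that E(3) ee by simp
  define g where "g x = (\<Sum>e\<in>E. (sqrt (l e) * (x \<bullet> e)) *\<^sub>R e)" for x
  have lin: "linear g"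
    unfolding g_def
    by (intro linearI) (simp_all add: inner_add algebra_simps sum.distrib scaleR_sum_right)
  define B where "B = matrix g"
  have B: "B *v x = g x" for x
    using lin by (simp add: B_def)
  have ge: "g e = sqrt (l e) *\<^sub>R e" if "e \<in> E" for e
  proof -
    have "g e = (\<Sum>e'\<in>E. if e' = e then sqrt (l e) *\<^sub>R e else 0)"
      unfolding g_def using that by (intro sum.cong) (auto simp: ee)
    then show ?thesis using fin that by simp
  qed
  have sym: "x \<bullet> g y = g x \<bullet> y" for x y
    by (simp add: g_def inner_sum_left inner_sum_right mult_ac inner_commute)
  have "transpose B = B"
  proof -
    have "(transpose B *v x - B *v x) \<bullet> y = 0" for x y
      using transpose_inner[of x B y] sym by (simp add: B inner_diff)
    then show ?thesis
      unfolding matrix_eq by (metis inner_eq_zero_iff eq_iff_diff_eq_0)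
  qed
  moreover have "0 \<le> v \<bullet> (B *v v)" for v
    unfolding B g_def inner_sum_right using l
    by (intro sum_nonneg) (auto simp: inner_commute mult.assoc)
  moreover have "B ** B = A"
    using E(3) l by (intro matrix_eq_on_spanning[OF E(4)])
      (simp add: matrix_vector_mul_assoc[symmetric] B ge linear_cmul[OF lin])
  ultimately show ?thesis
    unfolding psd_def by blast
qed

lemma psd_sqrt_unique:
  fixes B C :: "real^'n^'n"
  assumes B: "psd B" and C: "psd C" and eq: "B ** B = C ** C"
  shows "B = C"
proof -
  have "transpose (B - C) = B - C"
    using psdD(1)[OF B] psdD(1)[OF C] by (simp add: transpose_def vec_eq_iff)
  then obtain E l where E: "\<And>e. e \<in> E \<Longrightarrow> norm e = 1"
    "\<And>e. e \<in> E \<Longrightarrow> (B - C) *v e = l e *\<^sub>R e" "span E = UNIV"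
    using symmetric_eigenbasis by metis
  have "B *v e = C *v e" if e: "e \<in> E" for e
  proof -
    have Be: "B *v e = C *v e + l e *\<^sub>R e"
      using E(2)[OF e] by (simp add: matrix_vector_mult_diff_rdistrib algebra_simps)
    have ee: "e \<bullet> e = 1"
      using E(1)[OF e] by (simp flip: power2_norm_eq_inner)
    have "(B *v e) \<bullet> (B *v e) = e \<bullet> ((B ** B) *v e)"
      by (simp add: psdD(3)[OF B] flip: matrix_vector_mul_assoc)
    also have "\<dots> = (C *v e) \<bullet> (C *v e)"
      by (simp add: eq psdD(3)[OF C] flip: matrix_vector_mul_assoc)
    \<comment> \<open>Expanding \<open>|B e|\<^sup>2\<close> in terms of \<open>C e\<close> shows \<open>l (e \<bullet> B e + e \<bullet> C e) = 0\<close>, two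
      nonnegative summands whose difference is \<open>l\<close>.\<close>
    finally have "l e * (2 * (e \<bullet> (C *v e)) + l e) = 0"
      by (simp add: Be inner_add ee inner_commute algebra_simps)
    moreover have "0 \<le> e \<bullet> (C *v e)" "0 \<le> e \<bullet> (C *v e) + l e"
      using psdD(2)[OF C, of e] psdD(2)[OF B, of e] by (auto simp: Be inner_add ee)
    ultimately have "l e = 0"
      by (auto simp: mult_eq_0_iff)
    then show ?thesis by (simp add: Be)
  qed
  then show ?thesis
    by (rule matrix_eq_on_spanning[OF E(3)])
qed

lemma psd_sqrt:
  assumes "psd A"
  shows "psd (psd_sqrt A)" "psd_sqrt A ** psd_sqrt A = A"
proof -
  have "\<exists>!B. psd B \<and> B ** B = A"
    using psd_sqrt_exists[OF assms] psd_sqrt_unique by blast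
  from theI'[OF this] show "psd (psd_sqrt A)" "psd_sqrt A ** psd_sqrt A = A"
    by (simp_all add: psd_sqrt_def)
qed

lemma psd_sqrt_eqI:
  assumes "psd B" "B ** B = A"
  shows "psd_sqrt A = B"
  unfolding psd_sqrt_def using assms psd_sqrt_unique by (intro the_equality) auto

text \<open>The rank-one matrix \<open>v w\<^sup>T\<close>.\<close>

definition outer :: "real^'n \<Rightarrow> real^'m \<Rightarrow> real^'m^'n" where
  "outer v w = (\<chi> i j. v $ i * w $ j)"

lemma matrix_mult_outer: "P ** outer v w = outer (P *v v) w"
  by (simp add: outer_def matrix_matrix_mult_def matrix_vector_mult_def vec_eq_iff
      sum_distrib_right mult.assoc)

lemma outer_mult_vec: "outer a b *v w = (b \<bullet> w) *\<^sub>R a"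
  by (simp add: outer_def matrix_vector_mult_def inner_vec_def vec_eq_iff
      sum_distrib_left mult_ac)

lemma trace_outer: "trace (outer a b) = a \<bullet> b"
  by (simp add: trace_def outer_def inner_vec_def)

text \<open>The matrix of the reflection in the hyperplane orthogonal to a unit vector \<open>v\<close>.\<close>

definition householder :: "real^'n \<Rightarrow> real^'n^'n" where
  "householder v = mat 1 - 2 *\<^sub>R outer v v"

lemma scaleR_matrix_mult: "(c *\<^sub>R A) ** (B :: real^'n^'m) = c *\<^sub>R (A ** B)"
  "(A :: real^'m^'k) ** (c *\<^sub>R B) = c *\<^sub>R (A ** B)"
  by (simp_all add: matrix_matrix_mult_def vec_eq_iff sum_distrib_left mult_ac)

lemma mult_householder:
  fixes P :: "real^'n^'m"
  shows "P ** householder v = P - 2 *\<^sub>R outer (P *v v) v"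
proof -
  have "P ** (A - C) = P ** A - P ** C" for A C :: "real^'n^'n"
    by (simp add: matrix_matrix_mult_def vec_eq_iff algebra_simps sum_subtractf)
  then show ?thesis
    by (simp add: householder_def scaleR_matrix_mult matrix_mult_outer)
qed

lemma orthogonal_matrix_householder:
  assumes "norm v = 1"
  shows "orthogonal_matrix (householder v)"
proof -
  have vv: "v \<bullet> v = 1"
    using assms by (simp flip: power2_norm_eq_inner)
  have t: "transpose (householder v) = householder v"
    by (simp add: householder_def transpose_def outer_def vec_eq_iff mat_def mult.commute)
  have "householder v *v v = - v"
    by (simp add: householder_def matrix_vector_mult_diff_rdistrib outer_def matrix_vector_mult_def
        vec_eq_iff mult.assoc sum_distrib_left[symmetric] vv[unfolded inner_vec_def, simplified]
        sum_subtractf mat_def left_diff_distrib if_distrib[of "\<lambda>x. x * _"] cong: if_cong)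
  then show ?thesis
    unfolding orthogonal_matrix t mult_householder
    by (simp add: householder_def outer_def vec_eq_iff)
qed

lemma compact_orthogonal_matrices: "compact {Q :: real^'n^'n. orthogonal_matrix Q}"
proof -
  have "norm Q \<le> real CARD('n)" if "orthogonal_matrix Q" for Q :: "real^'n^'n"
  proof -
    have "norm (Q $ i) = 1" for i
      using that by (auto simp: orthogonal_matrix_orthonormal_rows row_def vec_nth_inverse)
    then show ?thesis
      using L2_set_le_sum[of UNIV "\<lambda>i. norm (Q $ i)"] by (simp add: norm_vec_def)
  qed
  then have "bounded {Q :: real^'n^'n. orthogonal_matrix Q}"
    by (auto simp: bounded_iff)
  moreover have "closed {Q :: real^'n^'n. transpose Q ** Q = mat 1}"
    unfolding matrix_matrix_mult_def transpose_def
    by (intro closed_Collect_eq continuous_intros continuous_on_vec_lambda)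
  ultimately show ?thesis
    by (simp add: compact_eq_bounded_closed orthogonal_matrix)
qed

text \<open>Maximising \<open>tr (B Q)\<close> over the compact set of orthogonal \<open>Q\<close>: comparing a maximiser with
  its compositions with one reflection shows that \<open>P = B Q\<close> has a nonnegative quadratic form, with two
  reflections that \<open>P\<close> is symmetric. No invertibility of \<open>B\<close> is needed.\<close>

lemma polar_decomposition:
  fixes B :: "real^'n^'n"
  obtains Q where "orthogonal_matrix Q" "psd (B ** Q)"
proof -
  have "continuous_on {Q :: real^'n^'n. orthogonal_matrix Q} (\<lambda>Q. trace (B ** Q))"
    unfolding trace_def matrix_matrix_mult_def by (simp, intro continuous_intros)
  moreover have "{Q :: real^'n^'n. orthogonal_matrix Q} \<noteq> {}"
    using orthogonal_matrix_id by blast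
  ultimately obtain Q where Q: "orthogonal_matrix Q"
    and max: "\<And>W. orthogonal_matrix W \<Longrightarrow> trace (B ** W) \<le> trace (B ** Q)"
    using continuous_attains_sup[OF compact_orthogonal_matrices] by (metis mem_Collect_eq)
  define P where "P = B ** Q"
  have max': "trace (P ** W) \<le> trace P" if "orthogonal_matrix W" for W
    using max[OF orthogonal_matrix_mul[OF Q that]] by (simp add: P_def matrix_mul_assoc)
  have tr: "trace (c *\<^sub>R X) = c * trace X" for c and X :: "real^'n^'n"
    by (simp add: trace_def sum_distrib_left)
  have nonneg1: "0 \<le> v \<bullet> (P *v v)" if "norm v = 1" for v
    using max'[OF orthogonal_matrix_householder[OF that]]
    by (simp add: mult_householder trace_sub tr trace_outer inner_commute)
  have nonneg: "0 \<le> v \<bullet> (P *v v)" for v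
  proof (cases "v = 0")
    case False
    have "v \<bullet> (P *v v) = (norm v)\<^sup>2 * ((v /\<^sub>R norm v) \<bullet> (P *v (v /\<^sub>R norm v)))"
      using False by (simp add: matrix_vector_mult_scaleR power2_eq_square field_simps)
    also have "\<dots> \<ge> 0"
      using False by (intro mult_nonneg_nonneg nonneg1) auto
    finally show ?thesis .
  qed simp
  have two1: "2 * (v \<bullet> w) * (w \<bullet> (P *v v)) \<le> v \<bullet> (P *v v) + w \<bullet> (P *v w)"
    if "norm v = 1" "norm w = 1" for v w
  proof -
    have "trace (P ** householder v ** householder w) \<le> trace P"
      using max'[OF orthogonal_matrix_mul[OF orthogonal_matrix_householder[OF that(1)]
          orthogonal_matrix_householder[OF that(2)]]]
      by (simp add: matrix_mul_assoc)
    then have "trace P - 2 * (v \<bullet> (P *v v)) - 2 * (w \<bullet> (P *v w)) + 4 * (v \<bullet> w) * (w \<bullet> (P *v v)) \<le> trace P"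
      by (simp add: mult_householder[of _ w]) (simp add: mult_householder trace_sub trace_add tr trace_outer
          matrix_vector_mult_diff_rdistrib scaleR_matrix_vector_assoc[symmetric] outer_mult_vec
          inner_diff inner_commute algebra_simps)
    then show ?thesis by simp
  qed
  have two: "2 * (v \<bullet> w) * (w \<bullet> (P *v v)) \<le> (w \<bullet> w) * (v \<bullet> (P *v v)) + w \<bullet> (P *v w)"
    if v: "norm v = 1" for v w
  proof (cases "w = 0")
    case False
    define c where "c = norm w"
    define u where "u = w /\<^sub>R c"
    have c: "c > 0" using False by (simp add: c_def)
    have w: "w = c *\<^sub>R u" and u: "norm u = 1"
      using c by (auto simp: u_def c_def)
    have "c\<^sup>2 * (2 * (v \<bullet> u) * (u \<bullet> (P *v v))) \<le> c\<^sup>2 * (v \<bullet> (P *v v) + u \<bullet> (P *v u))"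
      using two1[OF v u] by (intro mult_left_mono) auto
    then show ?thesis
      using u by (simp add: w matrix_vector_mult_scaleR power2_eq_square algebra_simps norm_eq_1)
  qed simp
  have sym0: "z \<bullet> (P *v v) = v \<bullet> (P *v z)" if v: "norm v = 1" and z: "v \<bullet> z = 0" for v z
  proof -
    have "0 \<le> t * (v \<bullet> (P *v z) - z \<bullet> (P *v v)) + t\<^sup>2 * ((z \<bullet> z) * (v \<bullet> (P *v v)) + z \<bullet> (P *v z))" for t
      using two[OF v, of "v + t *\<^sub>R z"] v z
      by (simp add: inner_add inner_commute matrix_vector_right_distrib matrix_vector_mult_scaleR
          power2_eq_square algebra_simps norm_eq_1)
    from linear_coeff_zero_if_quadratic_nonneg[OF this] show ?thesis by simp
  qed
  have sym1: "z \<bullet> (P *v v) = v \<bullet> (P *v z)" if v: "norm v = 1" for v z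
  proof -
    define z' where "z' = z - (v \<bullet> z) *\<^sub>R v"
    have "v \<bullet> z' = 0" using v by (simp add: z'_def inner_diff norm_eq_1)
    then have "z' \<bullet> (P *v v) = v \<bullet> (P *v z')" by (rule sym0[OF v])
    then show ?thesis
      by (simp add: z'_def inner_diff matrix_vector_mult_diff_distrib matrix_vector_mult_scaleR)
  qed
  have "z \<bullet> (P *v v) = v \<bullet> (P *v z)" for v z
  proof (cases "v = 0")
    case False
    have "z \<bullet> (P *v (v /\<^sub>R norm v)) = (v /\<^sub>R norm v) \<bullet> (P *v z)"
      using False by (intro sym1) auto
    then show ?thesis
      using False by (simp add: matrix_vector_mult_scaleR)
  qed simp
  then have "(transpose P *v x - P *v x) \<bullet> y = 0" for x y
    using transpose_inner[of x P y] by (simp add: inner_diff inner_commute)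
  then have "transpose P = P"
    unfolding matrix_eq by (metis inner_eq_zero_iff eq_iff_diff_eq_0)
  then show thesis
    using that[OF Q] nonneg by (simp add: psd_def P_def)
qed

text \<open>Every square root \<open>B\<close> of \<open>S\<close>, in the sense \<open>B B\<^sup>T = S\<close>, is the symmetric one up to an
  orthogonal factor, also when \<open>S\<close> is singular.\<close>

lemma matrix_factor_eq_psd_sqrt:
  fixes B :: "real^'n^'n"
  obtains Q where "orthogonal_matrix Q" "psd_sqrt (B ** transpose B) = B ** Q"
proof -
  obtain Q where Q: "orthogonal_matrix Q" "psd (B ** Q)"
    by (rule polar_decomposition)
  have "(B ** Q) ** (B ** Q) = (B ** Q) ** transpose (B ** Q)"
    using psdD(1)[OF Q(2)] by simp
  also have "\<dots> = B ** (Q ** transpose Q) ** transpose B"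
    by (simp add: matrix_transpose_mul matrix_mul_assoc)
  also have "\<dots> = B ** transpose B"
    using Q(1) by (simp add: orthogonal_matrix_def)
  finally show thesis
    using that[OF Q(1)] psd_sqrt_eqI[OF Q(2)] by simp
qed

lemma psd_invertible_pos:
  fixes A :: "real^'n^'n"
  assumes A: "psd A" "invertible A" and v: "v \<noteq> 0"
  shows "0 < v \<bullet> (A *v v)"
proof -
  let ?B = "psd_sqrt A"
  have eq: "v \<bullet> (A *v v) = (?B *v v) \<bullet> (?B *v v)"
    using psdD(3)[OF psd_sqrt(1)[OF A(1)], of v "?B *v v"]
    by (simp add: matrix_vector_mul_assoc psd_sqrt(2)[OF A(1)])
  have "?B *v v \<noteq> 0"
  proof
    assume "?B *v v = 0"
    then have "A *v v = 0"
      using psd_sqrt(2)[OF A(1)] by (metis matrix_vector_mul_assoc matrix_vector_mult_0_right)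
    then show False
      using A(2) v by (metis invertible_left_inverse matrix_left_invertible_ker)
  qed
  then show ?thesis by (simp add: eq)
qed

lemma invertible_of_pos:
  fixes A :: "real^'n^'n"
  assumes "\<And>v. v \<noteq> 0 \<Longrightarrow> 0 < v \<bullet> (A *v v)"
  shows "invertible A"
  unfolding invertible_left_inverse matrix_left_invertible_ker
  using assms by (metis inner_zero_right less_irrefl)

lemma matrix_inv_inverse:
  fixes A :: "real^'n^'n"
  assumes "invertible A"
  shows "A ** matrix_inv A = mat 1" "matrix_inv A ** A = mat 1"
  using someI_ex[OF assms[unfolded invertible_def]] by (simp_all add: matrix_inv_def)

section \<open>Block matrices and Schur complements\<close>

lemma vcat_nth [simp]: "vcat v w $ Inl a = v $ a" "vcat v w $ Inr b = w $ b"
  by (simp_all add: vcat_def)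

lemma vcat_eq_iff: "x = vcat v w \<longleftrightarrow> split_vec x = (v, w)"
  by (auto simp: vcat_def split_vec_def vec_eq_iff split: sum.split)

lemma split_vec_vcat [simp]: "split_vec (vcat v w) = (v, w)"
  by (simp add: split_vec_def vec_eq_iff)

lemma vcat_split_vec: "vcat (fst (split_vec z)) (snd (split_vec z)) = z"
  by (metis vcat_eq_iff prod.collapse)

lemma sum_UNIV_Plus:
  fixes f :: "'a::finite + 'b::finite \<Rightarrow> 'c::comm_monoid_add"
  shows "(\<Sum>i\<in>UNIV. f i) = (\<Sum>a\<in>UNIV. f (Inl a)) + (\<Sum>b\<in>UNIV. f (Inr b))"
  by (simp add: sum.Plus flip: UNIV_Plus_UNIV)

lemma prod_UNIV_Plus:
  fixes f :: "'a::finite + 'b::finite \<Rightarrow> 'c::comm_monoid_mult"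
  shows "(\<Prod>i\<in>UNIV. f i) = (\<Prod>a\<in>UNIV. f (Inl a)) * (\<Prod>b\<in>UNIV. f (Inr b))"
  by (simp add: prod.Plus flip: UNIV_Plus_UNIV)

lemma vcat_mult_vec [simp]: "vcat A B *v z = vcat (A *v z) (B *v z)"
  by (simp add: vcat_def matrix_vector_mult_def vec_eq_iff split: sum.split)

lemma hcat_mult_vcat [simp]: "hcat A B *v vcat v w = A *v v + B *v w"
  by (simp add: hcat_def matrix_vector_mult_def vec_eq_iff sum_UNIV_Plus)

lemma inner_vcat [simp]: "vcat v w \<bullet> vcat v' w' = v \<bullet> v' + w \<bullet> w'"
  by (simp add: inner_vec_def sum_UNIV_Plus)

lemma vcat_add [simp]: "vcat v w + vcat v' w' = vcat (v + v') (w + w')"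
  by (simp add: vcat_def vec_eq_iff split: sum.split)

lemma transpose_vcat [simp]: "transpose (vcat A B) = hcat (transpose A) (transpose B)"
  by (simp add: vcat_def hcat_def transpose_def vec_eq_iff split: sum.split)

lemma transpose_hcat [simp]: "transpose (hcat A B) = vcat (transpose A) (transpose B)"
  by (simp add: vcat_def hcat_def transpose_def vec_eq_iff split: sum.split)

lemma matrix_eq_vcat:
  fixes A C :: "real^('a::finite + 'b::finite)^'m"
  shows "A = C \<longleftrightarrow> (\<forall>v w. A *v vcat v w = C *v vcat v w)"
  unfolding matrix_eq by (metis vcat_split_vec)

lemma vcat_eq_vcat_iff [simp]: "vcat a b = vcat c d \<longleftrightarrow> a = c \<and> b = d"
  by (simp add: vcat_eq_iff)

lemma vcat_zero [simp]: "vcat 0 0 = 0"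
  by (simp add: vcat_def vec_eq_iff split: sum.split)

lemma schur_complement:
  fixes SXX :: "real^'x^'x" and SXY :: "real^'y^'x" and SYX :: "real^'x^'y" and SYY :: "real^'y^'y"
  defines "S \<equiv> vcat (hcat SXX SXY) (hcat SYX SYY)"
    and "C \<equiv> SYY - SYX ** matrix_inv SXX ** SXY"
  assumes psd: "psd S" and inv: "invertible S"
  shows "transpose SXY = SYX" "psd SXX" "invertible SXX" "psd C" "invertible C"
proof -
  have "transpose S *v vcat a b = S *v vcat a b" for a b
    by (simp add: psdD(1)[OF psd])
  then have "transpose SXX *v a + transpose SYX *v b = SXX *v a + SXY *v b"
    "transpose SXY *v a + transpose SYY *v b = SYX *v a + SYY *v b" for a b
    by (simp_all add: S_def)
  from this[of _ 0] this[of 0] have sym: "transpose SXX = SXX" "transpose SXY = SYX"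
    "transpose SYX = SXY" "transpose SYY = SYY"
    by (simp_all add: matrix_eq)
  show "transpose SXY = SYX" by (rule sym)
  have posX: "0 < a \<bullet> (SXX *v a)" if "a \<noteq> 0" for a
    using psd_invertible_pos[OF psd inv, of "vcat a 0"] that
    by (simp add: S_def flip: vcat_zero)
  then show iX: "invertible SXX" by (rule invertible_of_pos)
  show "psd SXX"
    unfolding psd_def using sym posX by (metis inner_zero_left less_imp_le order_refl)
  have mi: "SXX ** matrix_inv SXX = mat 1" "matrix_inv SXX ** SXX = mat 1"
    by (rule matrix_inv_inverse[OF iX])+
  have ti: "transpose (matrix_inv SXX) = matrix_inv SXX"
    using sym(1) mi by (metis matrix_mul_assoc matrix_mul_lid matrix_mul_rid matrix_transpose_mul transpose_mat)
  have tC: "transpose C = C"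
  proof -
    have "transpose (SYX ** matrix_inv SXX ** SXY) = SYX ** matrix_inv SXX ** SXY"
      by (simp add: matrix_transpose_mul sym ti matrix_mul_assoc)
    moreover have "transpose (X - Y) = transpose X - transpose Y" for X Y :: "real^'y^'y"
      by (simp add: transpose_def vec_eq_iff)
    ultimately show ?thesis
      by (simp add: C_def sym)
  qed
  \<comment> \<open>The form of the Schur complement at \<open>b\<close> is that of \<open>S\<close> minimised over the first block.\<close>
  have posC: "0 < b \<bullet> (C *v b)" if b: "b \<noteq> 0" for b
  proof -
    have neg: "M *v (- v) = - (M *v v)" for M :: "real^'n^'m" and v
      by (simp add: matrix_vector_mult_def vec_eq_iff sum_negf)
    let ?a = "- (matrix_inv SXX *v (SXY *v b))"
    have "SXX *v ?a = - (SXY *v b)"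
      by (simp add: neg matrix_vector_mul_assoc matrix_mul_assoc mi)
    moreover have "SYX *v ?a + SYY *v b = C *v b"
      by (simp add: C_def matrix_vector_mult_diff_rdistrib neg
          matrix_vector_mul_assoc matrix_mul_assoc)
    ultimately have "S *v vcat ?a b = vcat 0 (C *v b)"
      by (simp add: S_def)
    moreover have "vcat ?a b \<noteq> 0"
      using b by (simp flip: vcat_zero)
    ultimately show ?thesis
      using psd_invertible_pos[OF psd inv, of "vcat ?a b"] by simp
  qed
  then show "invertible C" by (rule invertible_of_pos)
  show "psd C"
    unfolding psd_def using tC posC by (metis inner_zero_left less_imp_le order_refl)
qed

text \<open>\<open>B\<close> maps independent standard normal \<open>(a, b)\<close> to \<open>(A a, R A a + L b)\<close>, and \<open>M\<close> maps \<open>(c, (a, b))\<close> to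
  \<open>(b, A a, R A a + L b)\<close>; the zero columns of \<open>M\<close> only make it square.\<close>

lemma block_factor:
  fixes A :: "real^'x^'x" and R :: "real^'x^'y" and L :: "real^'y^'y"
    and B :: "real^('x + 'y)^('x + 'y)" and M :: "real^('y + ('x + 'y))^('y + ('x + 'y))"
  assumes B_def: "B = vcat (hcat A 0) (hcat (R ** A) L)"
    and M_def: "M = hcat 0 (vcat (hcat 0 (mat 1)) B)"
    and A: "transpose A = A" and L: "transpose L = L"
  shows "B ** transpose B =
      vcat (hcat (A ** A) (A ** A ** transpose R)) (hcat (R ** A ** A) (R ** A ** A ** transpose R + L ** L))"
    and "M ** transpose M =
      (vcat (hcat (mat 1) (hcat 0 L))
        (vcat (hcat 0 (hcat (A ** A) (A ** A ** transpose R)))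
              (hcat L (hcat (R ** A ** A) (R ** A ** A ** transpose R + L ** L))))
        :: real^('y + ('x + 'y))^('y + ('x + 'y)))"
proof -
  note lin = matrix_vector_right_distrib matrix_vector_mult_add_rdistrib
  have [simp]: "transpose (0 :: real^'a^'b) = 0"
    by (simp add: transpose_def vec_eq_iff)
  show "B ** transpose B =
      vcat (hcat (A ** A) (A ** A ** transpose R)) (hcat (R ** A ** A) (R ** A ** A ** transpose R + L ** L))"
    unfolding matrix_eq_vcat matrix_vector_mul_assoc[symmetric]
    by (simp add: B_def matrix_transpose_mul A L lin matrix_vector_mul_assoc matrix_mul_assoc add_ac)
  show "M ** transpose M =
      (vcat (hcat (mat 1) (hcat 0 L))
        (vcat (hcat 0 (hcat (A ** A) (A ** A ** transpose R)))
              (hcat L (hcat (R ** A ** A) (R ** A ** A ** transpose R + L ** L))))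
        :: real^('y + ('x + 'y))^('y + ('x + 'y)))"
    unfolding matrix_eq_vcat matrix_vector_mul_assoc[symmetric]
  proof (intro allI)
    fix u :: "real^'y" and w :: "real^('x + 'y)"
    obtain a b where w: "w = vcat a b" by (metis vcat_split_vec)
    show "M *v (transpose M *v vcat u w) =
      vcat (hcat (mat 1) (hcat 0 L))
        (vcat (hcat 0 (hcat (A ** A) (A ** A ** transpose R)))
              (hcat L (hcat (R ** A ** A) (R ** A ** A ** transpose R + L ** L)))) *v vcat u w"
      by (simp add: w M_def B_def matrix_transpose_mul A L lin matrix_vector_mul_assoc matrix_mul_assoc add_ac transpose_mat)
  qed
qed

section \<open>Rotation invariance and products of standard normal laws\<close>

text \<open>An orthogonal map sends Lebesgue measure to a translation invariant measure \<open>M\<close>. By Tonelli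
  and translation invariance of both measures, \<open>M A \<cdot> \<lambda> B = M B \<cdot> \<lambda> A\<close> for all Borel \<open>A\<close> and \<open>B\<close>; for
  \<open>B\<close> the unit ball, where the measures agree, this gives \<open>M = \<lambda>\<close>.\<close>

lemma distr_lborel_orthogonal_transformation:
  fixes f :: "'a::euclidean_space \<Rightarrow> 'a"
  assumes f: "orthogonal_transformation f"
  shows "distr lborel borel f = lborel"
proof (rule measure_eqI)
  define M where "M = distr lborel borel f"
  have lin: "linear f"
    using f by (rule orthogonal_transformation_linear)
  have fm [measurable]: "f \<in> borel_measurable borel"
    using lin by (intro borel_measurable_continuous_onI linear_continuous_on)
      (simp add: linear_conv_bounded_linear)
  have setsM [measurable_cong]: "sets M = sets borel"
    by (simp add: M_def)
  obtain g where g: "orthogonal_transformation g" "\<And>x. f (g x) = x" "\<And>x. g (f x) = x"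
    using orthogonal_transformation_inv[OF f] orthogonal_transformation_bij[OF f]
    by (metis bij_inv_eq_iff)
  have glin: "linear g"
    using g(1) by (rule orthogonal_transformation_linear)
  have gm [measurable]: "g \<in> borel_measurable borel"
    using glin by (intro borel_measurable_continuous_onI linear_continuous_on)
      (simp add: linear_conv_bounded_linear)
  interpret M: sigma_finite_measure M
  proof (rule sigma_finite_measure_distr[of _ borel g])
    have "distr M borel g = lborel"
      unfolding M_def by (subst distr_distr) (simp_all add: o_def g(3) distr_id2)
    then show "sigma_finite_measure (distr M borel g)"
      by (simp add: sigma_finite_lborel)
  qed (use setsM in measurable)
  interpret P: pair_sigma_finite M lborel ..
  have transl: "(\<integral>\<^sup>+x. h (x + c) \<partial>M) = (\<integral>\<^sup>+x. h x \<partial>M)"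
    if [measurable]: "h \<in> borel_measurable borel" for h :: "'a \<Rightarrow> ennreal" and c
  proof -
    have "(\<integral>\<^sup>+x. h (x + c) \<partial>M) = (\<integral>\<^sup>+x. h (f (g c + x)) \<partial>lborel)"
      by (simp add: M_def nn_integral_distr linear_add[OF lin] g(2) add.commute)
    also have "\<dots> = (\<integral>\<^sup>+x. h (f x) \<partial>distr lborel borel ((+) (g c)))"
      by (subst nn_integral_distr) simp_all
    also have "\<dots> = (\<integral>\<^sup>+x. h x \<partial>M)"
      by (simp add: lborel_distr_plus M_def nn_integral_distr)
    finally show ?thesis .
  qed
  have reflect: "(\<integral>\<^sup>+y. h (c - y) \<partial>lborel) = (\<integral>\<^sup>+y. h y \<partial>lborel)"
    if [measurable]: "h \<in> borel_measurable borel" for h :: "'a \<Rightarrow> ennreal" and c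
  proof -
    have "lborel = distr lborel borel (\<lambda>x. c - x)"
      using lborel_affine[of "-1::real" c] by (simp add: density_1)
    then have "(\<integral>\<^sup>+y. h y \<partial>lborel) = (\<integral>\<^sup>+y. h y \<partial>distr lborel borel (\<lambda>x. c - x))"
      by simp
    also have "\<dots> = (\<integral>\<^sup>+y. h (c - y) \<partial>lborel)"
      by (simp add: nn_integral_distr)
    finally show ?thesis by simp
  qed
  have exchange: "emeasure M A * emeasure lborel B = emeasure M B * emeasure lborel A"
    if [measurable]: "A \<in> sets borel" "B \<in> sets borel" for A B
  proof -
    have "emeasure M A * emeasure lborel B = (\<integral>\<^sup>+x. \<integral>\<^sup>+y. indicator A x * indicator B y \<partial>lborel \<partial>M)"
      by (simp add: nn_integral_cmult nn_integral_multc setsM)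
    also have "\<dots> = (\<integral>\<^sup>+x. \<integral>\<^sup>+y. indicator A x * indicator B (x + y) \<partial>lborel \<partial>M)"
    proof (rule nn_integral_cong)
      fix x
      have "(\<integral>\<^sup>+y. (indicator A x * indicator B y :: ennreal) \<partial>lborel) =
          (\<integral>\<^sup>+y. indicator A x * indicator B y \<partial>distr lborel borel ((+) x))"
        by (simp add: lborel_distr_plus)
      then show "(\<integral>\<^sup>+y. (indicator A x * indicator B y :: ennreal) \<partial>lborel) =
          (\<integral>\<^sup>+y. indicator A x * indicator B (x + y) \<partial>lborel)"
        by (subst (asm) nn_integral_distr) simp_all
    qed
    also have "\<dots> = (\<integral>\<^sup>+y. \<integral>\<^sup>+x. indicator A x * indicator B (x + y) \<partial>M \<partial>lborel)"
      by (rule P.Fubini'[symmetric]) simp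
    also have "\<dots> = (\<integral>\<^sup>+y. \<integral>\<^sup>+x. indicator A (x - y) * indicator B x \<partial>M \<partial>lborel)"
    proof (rule nn_integral_cong)
      fix y
      show "(\<integral>\<^sup>+x. (indicator A x * indicator B (x + y) :: ennreal) \<partial>M) =
          (\<integral>\<^sup>+x. indicator A (x - y) * indicator B x \<partial>M)"
        using transl[of "\<lambda>x. indicator A (x - y) * indicator B x" y] by simp
    qed
    also have "\<dots> = (\<integral>\<^sup>+x. \<integral>\<^sup>+y. indicator A (x - y) * indicator B x \<partial>lborel \<partial>M)"
      by (rule P.Fubini') simp
    also have "\<dots> = (\<integral>\<^sup>+x. emeasure lborel A * indicator B x \<partial>M)"
      by (intro nn_integral_cong) (simp add: nn_integral_multc reflect)
    finally show ?thesis
      by (subst (asm) nn_integral_cmult_indicator) (simp_all add: setsM mult.commute)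
  qed
  have "f -` ball 0 1 = ball 0 1"
    using orthogonal_transformation_norm[OF f] by auto
  then have ball: "emeasure M (ball 0 1) = emeasure lborel (ball 0 1 :: 'a set)"
    by (simp add: M_def emeasure_distr)
  have pos: "emeasure lborel (ball 0 1 :: 'a set) \<noteq> 0"
    using content_ball_pos[of 1 "0 :: 'a"]
    by (auto simp: measure_def)
  have fin: "emeasure lborel (ball 0 1 :: 'a set) \<noteq> \<infinity>"
    using emeasure_bounded_finite[of "ball 0 1 :: 'a set"] by auto
  show "emeasure (distr lborel borel f) A = emeasure lborel A"
    if "A \<in> sets (distr lborel borel f)" for A
  proof -
    have "emeasure lborel (ball 0 1 :: 'a set) * emeasure M A = emeasure lborel (ball 0 1 :: 'a set) * emeasure lborel A"
      using exchange[of A "ball 0 1"] that by (simp add: ball mult.commute)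
    then show ?thesis
      using pos fin by (simp add: M_def ennreal_mult_cancel_left)
  qed
qed simp

lemma Basis_cart: "Basis = range (\<lambda>i::'n::finite. axis i (1::real))"
  by (auto simp: Basis_vec_def)

lemma prod_Basis_cart:
  fixes g :: "(real^'n) \<Rightarrow> 'b::comm_monoid_mult"
  shows "(\<Prod>b\<in>Basis. g b) = (\<Prod>i\<in>UNIV. g (axis i 1))"
  unfolding Basis_cart by (subst prod.reindex) (auto intro!: injI simp: axis_eq_axis)

lemma nn_integral_lborel_cart_prod:
  fixes f :: "'n::finite \<Rightarrow> real \<Rightarrow> ennreal"
  assumes [measurable]: "\<And>i. f i \<in> borel_measurable borel"
  shows "(\<integral>\<^sup>+z. (\<Prod>i\<in>UNIV. f i (z $ i)) \<partial>lborel) = (\<Prod>i\<in>UNIV. \<integral>\<^sup>+x. f i x \<partial>lborel)"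
proof -
  \<comment> \<open>The family \<open>f\<close>, reindexed by the basis vectors.\<close>
  define g where "g b = f (THE i. b = axis i 1)" for b :: "real^'n"
  have g: "g (axis i 1) = f i" for i
    by (simp add: g_def axis_eq_axis)
  have "(\<integral>\<^sup>+z. (\<Prod>b\<in>Basis. g b (z \<bullet> b)) \<partial>lborel) = (\<Prod>b\<in>Basis. \<integral>\<^sup>+x. g b x \<partial>lborel)"
    by (intro nn_integral_lborel_prod) (auto simp: Basis_cart g)
  then show ?thesis
    by (simp add: prod_Basis_cart g inner_axis)
qed

lemma sets_std_gaussian [simp, measurable_cong]: "sets std_gaussian = sets borel"
  and space_std_gaussian [simp]: "space std_gaussian = UNIV"
  by (simp_all add: std_gaussian_def)

lemma measurable_gaussian_density [measurable]:
  "(\<lambda>z::real^'n. ennreal (\<Prod>i\<in>UNIV. std_normal_density (z $ i))) \<in> borel_measurable borel"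
  by (intro measurable_compose[OF _ measurable_ennreal] borel_measurable_continuous_onI)
     (simp add: std_normal_density_def, intro continuous_intros, auto)

lemma nn_integral_std_gaussian_prod:
  fixes g :: "'n::finite \<Rightarrow> real \<Rightarrow> ennreal"
  assumes [measurable]: "\<And>i. g i \<in> borel_measurable borel"
  shows "(\<integral>\<^sup>+z. (\<Prod>i\<in>UNIV. g i (z $ i)) \<partial>std_gaussian)
    = (\<Prod>i\<in>UNIV. \<integral>\<^sup>+x. ennreal (std_normal_density x) * g i x \<partial>lborel)"
proof -
  have "(\<integral>\<^sup>+z. (\<Prod>i\<in>UNIV. g i (z $ i)) \<partial>std_gaussian)
    = (\<integral>\<^sup>+z. (\<Prod>i\<in>UNIV. ennreal (std_normal_density (z $ i)) * g i (z $ i)) \<partial>lborel)"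
    unfolding std_gaussian_def
    by (subst nn_integral_density) (auto simp: prod_ennreal[symmetric] prod.distrib)
  also have "\<dots> = (\<Prod>i\<in>UNIV. \<integral>\<^sup>+x. ennreal (std_normal_density x) * g i x \<partial>lborel)"
    by (subst nn_integral_lborel_cart_prod) auto
  finally show ?thesis .
qed

lemma nn_integral_std_normal_density: "(\<integral>\<^sup>+x. ennreal (std_normal_density x) \<partial>lborel) = 1"
  by (subst nn_integral_eq_integral) (auto simp: integrable_normal_density integral_normal_density)

lemma prob_space_std_gaussian: "prob_space (std_gaussian :: (real^'n) measure)"
  using nn_integral_std_gaussian_prod[of "\<lambda>(i::'n) x. 1"]
  by (intro prob_spaceI) (simp add: nn_integral_std_normal_density)

interpretation std_gaussian: prob_space "std_gaussian :: (real^'n) measure"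
  by (rule prob_space_std_gaussian)

lemma integrable_norm_sq_std_gaussian:
  "integrable std_gaussian (\<lambda>z :: real^'n. (norm z)\<^sup>2)"
proof -
  have "integrable std_gaussian (\<lambda>z :: real^'n. (z $ k)\<^sup>2)" for k
  proof (rule integrableI_nonneg)
    have eq: "ennreal ((z $ k)\<^sup>2) = (\<Prod>i\<in>UNIV. if i = k then ennreal ((z $ i)\<^sup>2) else 1)" for z :: "real^'n"
      by (simp add: prod.delta)
    have "(\<integral>\<^sup>+z. ennreal ((z $ k)\<^sup>2) \<partial>std_gaussian) = (\<Prod>i\<in>UNIV. \<integral>\<^sup>+x.
        ennreal (std_normal_density x) * (if i = k then ennreal (x\<^sup>2) else 1) \<partial>lborel)"
      unfolding eq
      by (rule nn_integral_std_gaussian_prod[of "\<lambda>i x. if i = k then ennreal (x\<^sup>2) else 1"]) simp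
    also have "\<dots> = (\<Prod>i\<in>UNIV. if i = k then
        \<integral>\<^sup>+x. ennreal (std_normal_density x) * ennreal (x\<^sup>2) \<partial>lborel else 1)"
      by (intro prod.cong refl) (simp add: nn_integral_std_normal_density)
    also have "\<dots> = (\<integral>\<^sup>+x. ennreal (std_normal_density x) * ennreal (x\<^sup>2) \<partial>lborel)"
      by (simp add: prod.delta)
    also have "\<dots> < \<infinity>"
      using integrable_std_normal_moment[of 2] unfolding integrable_iff_bounded
      by (simp add: abs_mult ennreal_mult)
    finally show "(\<integral>\<^sup>+(z::real^'n). ennreal ((z $ k)\<^sup>2) \<partial>std_gaussian) < \<infinity>" .
  qed auto
  then show ?thesis
    by (simp add: power2_norm_eq_inner inner_vec_def flip: power2_eq_square)
qed

lemma gaussian_density_eq_norm: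
  "(\<Prod>i\<in>UNIV. std_normal_density ((z :: real^'n) $ i)) = (1 / sqrt (2 * pi)) ^ CARD('n) * exp (- (norm z)\<^sup>2 / 2)"
proof -
  have "(\<Prod>i\<in>UNIV. std_normal_density (z $ i)) = (\<Prod>i\<in>(UNIV::'n set). 1 / sqrt (2 * pi)) * (\<Prod>i\<in>UNIV. exp (- (z $ i)\<^sup>2 / 2))"
    unfolding std_normal_density_def by (rule prod.distrib)
  also have "(\<Prod>i\<in>UNIV. exp (- (z $ i)\<^sup>2 / 2)) = exp (- (norm z)\<^sup>2 / 2)"
    by (simp add: exp_sum[symmetric] power2_norm_eq_inner inner_vec_def sum_negf sum_divide_distrib
        flip: power2_eq_square)
  finally show ?thesis by simp
qed

lemma distr_std_gaussian_orthogonal_transformation: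
  fixes f :: "real^'n \<Rightarrow> real^'n"
  assumes f: "orthogonal_transformation f"
  shows "distr std_gaussian borel f = std_gaussian"
proof -
  let ?d = "\<lambda>z::real^'n. ennreal (\<Prod>i\<in>UNIV. std_normal_density (z $ i))"
  have [measurable]: "f \<in> borel_measurable borel"
    using orthogonal_transformation_linear[OF f]
    by (intro borel_measurable_continuous_onI linear_continuous_on) (simp add: linear_conv_bounded_linear)
  have "distr (density lborel ?d) borel f = distr (density lborel (\<lambda>z. ?d (f z))) borel f"
    by (simp add: gaussian_density_eq_norm orthogonal_transformation_norm[OF f])
  also have "\<dots> = density (distr lborel borel f) ?d"
    by (subst density_distr) auto
  finally show ?thesis
    by (simp add: std_gaussian_def distr_lborel_orthogonal_transformation[OF f])
qed

text \<open>The mean vanishes because the law is invariant under \<open>z \<mapsto> - z\<close>.\<close>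

lemma integral_std_gaussian: "(\<integral>z. z \<partial>(std_gaussian :: (real^'n) measure)) = 0"
proof -
  have "(\<integral>z. z \<partial>(std_gaussian :: (real^'n) measure)) = (\<integral>z. z \<partial>distr std_gaussian borel uminus)"
    by (subst distr_std_gaussian_orthogonal_transformation)
      (auto simp: orthogonal_transformation_def linear_uminus)
  also have "\<dots> = - (\<integral>z. z \<partial>(std_gaussian :: (real^'n) measure))"
    by (subst integral_distr) auto
  finally have "2 *\<^sub>R (\<integral>z. z \<partial>(std_gaussian :: (real^'n) measure)) = 0"
    by (simp only: scaleR_2 eq_neg_iff_add_eq_0)
  then show ?thesis by simp
qed

text \<open>A normal law may be built from any square factor \<open>B\<close> of its covariance matrix.\<close>

lemma gaussian_matrix_factor:
  fixes B :: "real^'n^'n"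
  shows "gaussian m (B ** transpose B) = distr std_gaussian borel (\<lambda>z. m + B *v z)"
proof -
  obtain Q where Q: "orthogonal_matrix Q" "psd_sqrt (B ** transpose B) = B ** Q"
    by (rule matrix_factor_eq_psd_sqrt)
  have [measurable]: "(*v) C \<in> borel_measurable borel" for C :: "real^'n^'n"
    by (intro borel_measurable_continuous_onI matrix_vector_mult_linear_continuous_on)
  have "gaussian m (B ** transpose B) = distr (distr std_gaussian borel ((*v) Q)) borel (\<lambda>z. m + B *v z)"
    unfolding gaussian_def Q(2) by (subst distr_distr) (auto simp: o_def matrix_vector_mul_assoc)
  also have "distr std_gaussian borel ((*v) Q) = std_gaussian"
    using Q(1) by (intro distr_std_gaussian_orthogonal_transformation)
      (simp add: orthogonal_transformation_matrix)
  finally show ?thesis .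
qed

lemma continuous_split_vec: "continuous_on UNIV (split_vec :: real^('a::finite + 'b::finite) \<Rightarrow> _)"
  unfolding split_vec_def by (intro continuous_intros continuous_on_vec_lambda)

lemma measurable_split_vec [measurable]:
  "(split_vec :: real^('a::finite + 'b::finite) \<Rightarrow> _) \<in> borel_measurable borel"
  by (rule borel_measurable_continuous_onI[OF continuous_split_vec])

lemma box_Pair_eq: "box (a, c) (b, d) = box a b \<times> box c d"
  by (force simp: box_def Basis_prod_def)

lemma distr_lborel_split_vec:
  "distr lborel borel split_vec = (lborel :: ((real^'a) \<times> (real^'b)) measure)"
proof (rule lborel_eqI[symmetric])
  fix l u :: "(real^'a) \<times> (real^'b)"
  assume le: "\<And>b. b \<in> Basis \<Longrightarrow> l \<bullet> b \<le> u \<bullet> b"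
  obtain l1 l2 u1 u2 where lu: "l = (l1, l2)" "u = (u1, u2)"
    by (cases l, cases u) auto
  have le1: "l1 $ i \<le> u1 $ i" for i
    using le[of "(axis i 1, 0)"] by (simp add: lu Basis_prod_def Basis_cart inner_axis)
  have le2: "l2 $ i \<le> u2 $ i" for i
    using le[of "(0, axis i 1)"] by (simp add: lu Basis_prod_def Basis_cart inner_axis)
  have le': "vcat l1 l2 \<bullet> b \<le> vcat u1 u2 \<bullet> b" if b: "b \<in> Basis" for b
  proof -
    obtain i where i: "b = axis i 1" using b by (auto simp: Basis_cart)
    show ?thesis using le1 le2 by (cases i) (simp_all add: i inner_axis)
  qed
  have "split_vec -` box l u = box (vcat l1 l2) (vcat u1 u2)"
  proof -
    have "split_vec x \<in> box l u \<longleftrightarrow> x \<in> box (vcat l1 l2) (vcat u1 u2)" for x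
    proof -
      obtain x1 x2 where x: "x = vcat x1 x2" by (metis vcat_split_vec)
      have "(x \<in> box (vcat l1 l2) (vcat u1 u2)) \<longleftrightarrow>
          (\<forall>i. l1 $ i < x1 $ i \<and> x1 $ i < u1 $ i) \<and> (\<forall>i. l2 $ i < x2 $ i \<and> x2 $ i < u2 $ i)"
        by (simp add: mem_box_cart x split_sum_all)
      then show ?thesis
        by (simp add: x lu box_Pair_eq mem_box_cart)
    qed
    then show ?thesis
      unfolding set_eq_iff vimage_eq by (intro allI)
  qed
  then have "emeasure (distr lborel borel split_vec) (box l u) = emeasure lborel (box (vcat l1 l2) (vcat u1 u2))"
    by (subst emeasure_distr) simp_all
  also have "\<dots> = ennreal (\<Prod>b\<in>Basis. (vcat u1 u2 - vcat l1 l2) \<bullet> b)"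
    by (rule emeasure_lborel_box) (rule le')
  also have "(\<Prod>b\<in>Basis. (vcat u1 u2 - vcat l1 l2) \<bullet> b) = (\<Prod>b\<in>Basis. (u1 - l1) \<bullet> b) * (\<Prod>b\<in>Basis. (u2 - l2) \<bullet> b)"
    by (simp add: prod_Basis_cart prod_UNIV_Plus inner_axis)
  also have "\<dots> = (\<Prod>b\<in>Basis. (u - l) \<bullet> b)"
    unfolding Basis_prod_def lu
    by (subst prod.union_disjoint) (simp_all add: prod.reindex inj_on_def disjoint_iff image_iff nonzero_Basis)
  finally show "emeasure (distr lborel borel split_vec) (box l u) = (\<Prod>b\<in>Basis. (u - l) \<bullet> b)" .
qed simp

lemma distr_std_gaussian_split_vec:
  "distr std_gaussian borel split_vec = (std_gaussian \<Otimes>\<^sub>M std_gaussian :: ((real^'a) \<times> (real^'b)) measure)"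
proof -
  let ?d = "\<lambda>z. ennreal (\<Prod>i\<in>UNIV. std_normal_density (z $ i))"
  let ?D = "\<lambda>(x, y). ?d (x :: real^'a) * ?d (y :: real^'b)"
  have "distr std_gaussian borel split_vec
      = distr (density lborel (\<lambda>z. ?D (split_vec z))) borel split_vec"
    unfolding std_gaussian_def split_vec_def
    by (simp add: prod_UNIV_Plus ennreal_mult prod_nonneg)
  also have "\<dots> = density (distr lborel borel split_vec) ?D"
    by (rule density_distr[symmetric]) (simp_all add: borel_prod, simp flip: borel_prod)
  also have "\<dots> = density (lborel \<Otimes>\<^sub>M lborel) ?D"
    by (simp add: distr_lborel_split_vec lborel_prod)
  also have "\<dots> = std_gaussian \<Otimes>\<^sub>M std_gaussian"
    using prob_space_std_gaussian[where 'n = 'b] unfolding std_gaussian_def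
    by (intro pair_measure_density[symmetric] sigma_finite_lborel prob_space_imp_sigma_finite) simp_all
  finally show ?thesis .
qed

section \<open>Integrability, relative entropy and conditional laws\<close>

lemma linear_borel_measurable:
  fixes f :: "'a::euclidean_space \<Rightarrow> 'b::euclidean_space"
  assumes "linear f"
  shows "f \<in> borel_measurable borel"
  using assms by (intro borel_measurable_continuous_onI linear_continuous_on)
    (simp add: linear_conv_bounded_linear)

lemma borel_fst [measurable]:
  "(fst :: 'a::second_countable_topology \<times> 'b::second_countable_topology \<Rightarrow> 'a) \<in> borel_measurable borel"
  and borel_snd [measurable]:
  "(snd :: 'a \<times> 'b \<Rightarrow> 'b) \<in> borel_measurable borel"
  by (simp_all flip: borel_prod)

lemma integrable_norm_sq_add:
  fixes f g :: "'a \<Rightarrow> 'b::euclidean_space"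
  assumes [measurable]: "f \<in> borel_measurable M" "g \<in> borel_measurable M"
    and f: "integrable M (\<lambda>x. (norm (f x))\<^sup>2)" and g: "integrable M (\<lambda>x. (norm (g x))\<^sup>2)"
  shows "integrable M (\<lambda>x. (norm (f x + g x))\<^sup>2)"
proof (rule Bochner_Integration.integrable_bound)
  show "integrable M (\<lambda>x. 2 * ((norm (f x))\<^sup>2 + (norm (g x))\<^sup>2))"
    using f g by auto
  show "AE x in M. norm ((norm (f x + g x))\<^sup>2) \<le> norm (2 * ((norm (f x))\<^sup>2 + (norm (g x))\<^sup>2))"
  proof (intro AE_I2)
    fix x
    have "(norm (f x + g x))\<^sup>2 \<le> (norm (f x) + norm (g x))\<^sup>2"
      by (intro power_mono norm_triangle_ineq) simp
    also have "\<dots> \<le> 2 * ((norm (f x))\<^sup>2 + (norm (g x))\<^sup>2)"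
      using sum_squares_bound[of "norm (f x)" "norm (g x)"] by (simp add: power2_sum)
    finally show "norm ((norm (f x + g x))\<^sup>2) \<le> norm (2 * ((norm (f x))\<^sup>2 + (norm (g x))\<^sup>2))"
      by simp
  qed
qed simp

lemma integrable_norm_sq_linear:
  fixes f :: "'a \<Rightarrow> 'b::euclidean_space" and T :: "'b \<Rightarrow> 'c::euclidean_space"
  assumes [measurable]: "f \<in> borel_measurable M" and T: "linear T"
    and f: "integrable M (\<lambda>x. (norm (f x))\<^sup>2)"
  shows "integrable M (\<lambda>x. (norm (T (f x)))\<^sup>2)"
proof -
  obtain B where B: "\<And>x. norm (T x) \<le> B * norm x"
    using linear_bounded[OF T] by blast
  have [measurable]: "T \<in> borel_measurable borel"
    by (rule linear_borel_measurable[OF T])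
  show ?thesis
  proof (rule Bochner_Integration.integrable_bound)
    show "integrable M (\<lambda>x. B\<^sup>2 * (norm (f x))\<^sup>2)"
      using f by auto
    show "AE x in M. norm ((norm (T (f x)))\<^sup>2) \<le> norm (B\<^sup>2 * (norm (f x))\<^sup>2)"
      using B by (auto simp flip: power_mult_distrib intro!: AE_I2 power_mono)
  qed simp
qed

lemma integrable_inner_of_norm_sq:
  fixes f g :: "'a \<Rightarrow> 'b::euclidean_space"
  assumes [measurable]: "f \<in> borel_measurable M" "g \<in> borel_measurable M"
    and f: "integrable M (\<lambda>x. (norm (f x))\<^sup>2)" and g: "integrable M (\<lambda>x. (norm (g x))\<^sup>2)"
  shows "integrable M (\<lambda>x. f x \<bullet> g x)"
proof (rule Bochner_Integration.integrable_bound)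
  show "integrable M (\<lambda>x. (norm (f x))\<^sup>2 + (norm (g x))\<^sup>2)"
    using f g by auto
  show "AE x in M. norm (f x \<bullet> g x) \<le> norm ((norm (f x))\<^sup>2 + (norm (g x))\<^sup>2)"
  proof (intro AE_I2)
    fix x
    have "2 * (norm (f x) * norm (g x)) \<le> (norm (f x))\<^sup>2 + (norm (g x))\<^sup>2"
      using sum_squares_bound[of "norm (f x)" "norm (g x)"] by simp
    moreover have "norm (f x \<bullet> g x) \<le> norm (f x) * norm (g x)"
      by (simp add: Cauchy_Schwarz_ineq2)
    ultimately show "norm (f x \<bullet> g x) \<le> norm ((norm (f x))\<^sup>2 + (norm (g x))\<^sup>2)"
      using mult_nonneg_nonneg[of "norm (f x)" "norm (g x)"] by simp
  qed
qed simp

lemma (in finite_measure) integrable_of_integrable_norm_sq: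
  fixes f :: "'a \<Rightarrow> 'b::euclidean_space"
  assumes [measurable]: "f \<in> borel_measurable M"
    and f: "integrable M (\<lambda>x. (norm (f x))\<^sup>2)"
  shows "integrable M f"
proof (rule Bochner_Integration.integrable_bound)
  show "integrable M (\<lambda>x. 1 + (norm (f x))\<^sup>2)"
    using f by auto
  show "AE x in M. norm (f x) \<le> norm (1 + (norm (f x))\<^sup>2)"
  proof (intro AE_I2)
    fix x
    show "norm (f x) \<le> norm (1 + (norm (f x))\<^sup>2)"
      using sum_squares_bound[of 1 "norm (f x)"] order_trans[of "norm (f x)" "2 * norm (f x)"] by simp
  qed
qed simp

lemma KL_nonneg:
  assumes "prob_space Q" "prob_space P" and s: "sets P = sets Q"
  shows "0 \<le> KL P Q"
proof (cases "absolutely_continuous Q P \<and> integrable P (entropy_density (exp 1) Q P)")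
  case True
  interpret Q: information_space Q "exp 1"
    using assms(1) by (simp add: information_space_def information_space_axioms_def)
  interpret P: prob_space P by fact
  \<comment> \<open>A real-valued version of the Radon-Nikodym derivative.\<close>
  define D where "D = (\<lambda>x. enn2real (RN_deriv Q P x))"
  have Dm [measurable]: "D \<in> borel_measurable Q"
    by (simp add: D_def)
  have fin: "AE x in Q. RN_deriv Q P x \<noteq> \<infinity>"
    using True s by (intro Q.RN_deriv_finite P.sigma_finite_measure_axioms) auto
  have "density Q D = density Q (RN_deriv Q P)"
    using fin by (intro density_cong) (auto simp: D_def ennreal_enn2real_if)
  then have PD: "P = density Q D"
    using True s by (simp add: Q.density_RN_deriv)
  have "integrable (density Q D) (\<lambda>x. log (exp 1) (D x))"
    using True unfolding PD[symmetric] by (simp add: entropy_density_def D_def comp_def)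
  then have "integrable Q (\<lambda>x. D x * log (exp 1) (D x))"
    by (subst (asm) integrable_density) (auto simp: D_def)
  then have "0 \<le> KL_divergence (exp 1) Q (density Q D)"
    using assms(2)[unfolded PD] by (intro Q.KL_nonneg) (auto simp: D_def)
  then show ?thesis
    using True by (simp add: KL_def flip: PD)
qed (auto simp: KL_def)

text \<open>The logarithm of the density is only evaluated where the density is positive, hence between
  \<open>0\<close> and \<open>ln B\<close>.\<close>

lemma KL_density_bounded:
  fixes f :: "'a \<Rightarrow> real"
  assumes "prob_space Q" "prob_space (density Q f)"
    and [measurable]: "f \<in> borel_measurable Q"
    and f: "\<And>x. f x = 0 \<or> 1 \<le> f x" "\<And>x. f x \<le> B"
  obtains k where "KL (density Q f) Q = ereal k"
proof -
  interpret Q: prob_space Q by fact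
  interpret P: prob_space "density Q f" by fact
  have ac: "absolutely_continuous Q (density Q f)"
    by (rule absolutely_continuousI_density) simp
  have "AE x in Q. ennreal (f x) = RN_deriv Q (density Q f) x"
    by (rule Q.RN_deriv_unique) auto
  moreover have "AE x in density Q f. f x \<noteq> 0"
    by (subst AE_density) auto
  ultimately have "AE x in density Q f. norm (entropy_density (exp 1) Q (density Q f) x) \<le> ln B"
    unfolding AE_density[OF measurable_compose[OF assms(3) measurable_ennreal]]
  proof eventually_elim
    case (elim x)
    show ?case
    proof
      assume "0 < ennreal (f x)"
      then have "1 \<le> f x" using f(1)[of x] by auto
      moreover have "entropy_density (exp 1) Q (density Q f) x = ln (f x)"
        using elim(1)[symmetric] \<open>1 \<le> f x\<close> by (simp add: entropy_density_def log_def)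
      ultimately show "norm (entropy_density (exp 1) Q (density Q f) x) \<le> ln B"
        using f(2)[of x] by simp
    qed
  qed
  then have "integrable (density Q f) (entropy_density (exp 1) Q (density Q f))"
    by (intro P.integrable_const_bound[where B = "ln B"]) auto
  then show thesis
    using ac that by (simp add: KL_def)
qed

text \<open>The defining property of a conditional law extends from rectangles to all nonnegative
  Borel functions.\<close>

lemma nn_integral_cond_law:
  fixes \<pi> :: "('u::euclidean_space \<times> 'v::euclidean_space) measure" and f :: "'u \<times> 'v \<Rightarrow> ennreal"
  assumes K: "cond_law \<pi> K" and p: "prob_space \<pi>" and s: "sets \<pi> = sets borel"
    and f: "f \<in> borel_measurable borel"
  shows "(\<integral>\<^sup>+w. f w \<partial>\<pi>) = (\<integral>\<^sup>+u. \<integral>\<^sup>+v. f (u, v) \<partial>K u \<partial>distr \<pi> borel fst)"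
proof -
  define \<mu> where "\<mu> = distr \<pi> borel fst"
  note [measurable_cong] = s
  interpret p: prob_space \<pi> by fact
  interpret \<mu>: prob_space \<mu>
    unfolding \<mu>_def by (rule p.prob_space_distr) measurable
  have smu [measurable_cong, simp]: "sets \<mu> = sets borel"
    by (simp add: \<mu>_def)
  have spmu [simp]: "space \<mu> = UNIV"
    by (simp add: \<mu>_def)
  have Kp: "K \<in> borel \<rightarrow>\<^sub>M prob_algebra borel"
    and Krect: "\<And>A B. A \<in> sets borel \<Longrightarrow> B \<in> sets borel \<Longrightarrow>
      emeasure \<pi> (A \<times> B) = (\<integral>\<^sup>+u\<in>A. emeasure (K u) B \<partial>\<mu>)"
    using K by (auto simp: cond_law_def \<mu>_def)
  have Km [measurable]: "K \<in> borel \<rightarrow>\<^sub>M subprob_algebra borel"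
    by (rule measurable_prob_algebraD[OF Kp])
  have Kp': "prob_space (K u)" and Ks [simp]: "sets (K u) = sets borel" for u
    using measurable_space[OF Kp, of u] by (auto simp: space_prob_algebra)
  have Pair_m [measurable]: "Pair u \<in> K u' \<rightarrow>\<^sub>M borel" for u :: 'u and u'
    by (subst measurable_cong_sets[OF Ks refl]) (simp flip: borel_prod)
  define N where "N u = distr (K u) borel (Pair u)" for u
  have Nm [measurable]: "N \<in> \<mu> \<rightarrow>\<^sub>M subprob_algebra borel"
    unfolding N_def
  proof (rule measurable_distr2[where M = borel])
    show "case_prod Pair \<in> \<mu> \<Otimes>\<^sub>M borel \<rightarrow>\<^sub>M (borel :: ('u \<times> 'v) measure)"
      unfolding borel_prod[symmetric] by simp
  qed simp
  have Ns: "sets (N u) = sets borel" for u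
    by (simp add: N_def)
  interpret B: prob_space "\<mu> \<bind> N"
    by (rule \<mu>.prob_space_bind[OF _ Nm]) (auto simp: N_def intro!: prob_space.prob_space_distr Kp')
  have rect: "emeasure (\<mu> \<bind> N) (A \<times> B) = emeasure \<pi> (A \<times> B)"
    if A: "A \<in> sets borel" and B: "B \<in> sets borel" for A B
  proof -
    have AB: "A \<times> B \<in> sets borel"
      using A B by (simp flip: borel_prod)
    have "emeasure (\<mu> \<bind> N) (A \<times> B) = (\<integral>\<^sup>+u. emeasure (N u) (A \<times> B) \<partial>\<mu>)"
      by (rule emeasure_bind[OF _ Nm AB]) simp
    also have "\<dots> = (\<integral>\<^sup>+u\<in>A. emeasure (K u) B \<partial>\<mu>)"
    proof (rule nn_integral_cong)
      fix u
      have "Pair u -` (A \<times> B) = (if u \<in> A then B else {})"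
        by auto
      moreover have "space (K u) = UNIV"
        using sets_eq_imp_space_eq[OF Ks] by simp
      ultimately show "emeasure (N u) (A \<times> B) = emeasure (K u) B * indicator A u"
        using AB by (simp add: N_def emeasure_distr)
    qed
    finally show ?thesis
      using Krect[OF A B] by simp
  qed
  have "\<mu> \<bind> N = \<pi>"
  proof (rule measure_eqI_generator_eq[where E = "{A \<times> B | A B. A \<in> sets borel \<and> B \<in> sets borel}"
        and \<Omega> = UNIV and A = "\<lambda>_. UNIV"])
    show "Int_stable {A \<times> B | A B. A \<in> sets (borel :: 'u measure) \<and> B \<in> sets (borel :: 'v measure)}"
      using Int_stable_pair_measure_generator[of "borel :: 'u measure" "borel :: 'v measure"] .
    have gen: "sets (borel :: ('u \<times> 'v) measure) = sigma_sets UNIV {A \<times> B | A B. A \<in> sets borel \<and> B \<in> sets borel}"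
      by (simp add: sets_pair_measure flip: borel_prod)
    show "sets (\<mu> \<bind> N) = sigma_sets UNIV {A \<times> B | A B. A \<in> sets borel \<and> B \<in> sets borel}"
      by (subst sets_bind[of _ _ borel]) (simp_all add: Ns gen)
    show "sets \<pi> = sigma_sets UNIV {A \<times> B | A B. A \<in> sets borel \<and> B \<in> sets borel}"
      by (simp add: s gen)
    show "range (\<lambda>_. UNIV) \<subseteq> {A \<times> B | A B. A \<in> sets (borel :: 'u measure) \<and> B \<in> sets (borel :: 'v measure)}"
      by (auto intro!: exI[of _ UNIV])
  qed (use rect in auto)
  then have "(\<integral>\<^sup>+w. f w \<partial>\<pi>) = (\<integral>\<^sup>+w. f w \<partial>(\<mu> \<bind> N))"
    by simp
  also have "\<dots> = (\<integral>\<^sup>+u. \<integral>\<^sup>+w. f w \<partial>N u \<partial>\<mu>)"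
    by (rule nn_integral_bind[OF f Nm])
  also have "\<dots> = (\<integral>\<^sup>+u. \<integral>\<^sup>+v. f (u, v) \<partial>K u \<partial>\<mu>)"
    unfolding N_def using f by (simp add: nn_integral_distr)
  finally show ?thesis by (simp add: \<mu>_def)
qed

lemma mult_vec_measurable [measurable]: "(*v) (A :: real^'n^'m) \<in> borel_measurable borel"
  by (rule linear_borel_measurable) simp

section \<open>Vector quantile regression with a linear Brenier map\<close>

text \<open>The reference law \<open>\<nu>\<close> is that of \<open>(X, m + R X + L V)\<close> with \<open>X \<sim> P\<close> centred, \<open>V \<sim> \<mu>\<close> independent of
  \<open>X\<close>, and \<open>L\<close> symmetric positive definite; \<open>L'\<close> is the inverse of \<open>L\<close>. Neither \<open>\<mu>\<close> nor \<open>P\<close> needs to be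
  normal.\<close>

locale linear_quantile_model =
  fixes \<mu> :: "'u::euclidean_space measure" and P :: "'x::euclidean_space measure"
    and m :: 'u and R :: "'x \<Rightarrow> 'u" and L L' :: "'u \<Rightarrow> 'u"
  assumes prob_mu: "prob_space \<mu>" and sets_mu [simp, measurable_cong]: "sets \<mu> = sets borel"
    and prob_P: "prob_space P" and sets_P [simp, measurable_cong]: "sets P = sets borel"
    and integrable_mu: "integrable \<mu> (\<lambda>u. (norm u)\<^sup>2)"
    and integrable_P: "integrable P (\<lambda>x. (norm x)\<^sup>2)"
    and mean_P: "(\<integral>x. x \<partial>P) = 0"
    and linear_R: "linear R" and linear_L: "linear L" and linear_L': "linear L'"
    and L_L' [simp]: "\<And>v. L (L' v) = v" and L'_L [simp]: "\<And>v. L' (L v) = v"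
    and L_sym: "\<And>u v. L u \<bullet> v = u \<bullet> L v"
    and L_pos: "\<And>u. u \<noteq> 0 \<Longrightarrow> 0 < u \<bullet> L u"
begin

sublocale mu: prob_space \<mu> by (rule prob_mu)
sublocale P: prob_space P by (rule prob_P)
sublocale P_mu: pair_prob_space P \<mu> ..

lemma space_mu [simp]: "space \<mu> = UNIV" and space_P [simp]: "space P = UNIV"
  using sets_eq_imp_space_eq[OF sets_mu] sets_eq_imp_space_eq[OF sets_P] by simp_all

lemma sets_P_mu [simp, measurable_cong]: "sets (P \<Otimes>\<^sub>M \<mu>) = sets borel"
  unfolding borel_prod[symmetric] by (rule sets_pair_measure_cong[OF sets_P sets_mu])

lemma R_measurable [measurable]: "R \<in> borel_measurable borel"
  and L_measurable [measurable]: "L \<in> borel_measurable borel"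
  and L'_measurable [measurable]: "L' \<in> borel_measurable borel"
  by (simp_all add: linear_borel_measurable linear_R linear_L linear_L')

definition \<nu> :: "('x \<times> 'u) measure" where
  "\<nu> = distr (P \<Otimes>\<^sub>M \<mu>) borel (\<lambda>(x, v). (x, m + R x + L v))"

text \<open>The variable \<open>V\<close> recovered from \<open>p = (x, y)\<close>, by solving \<open>y = m + R x + L v\<close> for \<open>v\<close>.\<close>

definition V :: "'x \<times> 'u \<Rightarrow> 'u" where
  "V p = L' (snd p - m - R (fst p))"

text \<open>The law of \<open>(V, X, Y)\<close>, a coupling of \<open>\<mu>\<close> and \<open>\<nu>\<close> whose first component is a function of the
  others.\<close>

definition \<pi>0 :: "('u \<times> 'x \<times> 'u) measure" where
  "\<pi>0 = distr \<nu> borel (\<lambda>p. (V p, p))"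

text \<open>The quadratic form of \<open>L\<close>.\<close>

definition q :: "'u \<Rightarrow> real" where
  "q w = w \<bullet> L w"

lemma V_measurable [measurable]: "V \<in> borel_measurable borel"
  unfolding V_def by measurable

lemma q_measurable [measurable]: "q \<in> borel_measurable borel"
  unfolding q_def by measurable

lemma sets_nu [simp, measurable_cong]: "sets \<nu> = sets borel" and space_nu [simp]: "space \<nu> = UNIV"
  by (simp_all add: \<nu>_def)

lemma decompose: "snd p = m + R (fst p) + L (V p)"
  by (simp add: V_def)

lemma model_map_measurable [measurable]: "(\<lambda>(x, v). (x, m + R x + L v)) \<in> borel_measurable borel"
  by (simp add: split_beta')

lemma prob_nu: "prob_space \<nu>"
  unfolding \<nu>_def by (rule P_mu.prob_space_distr) measurable

sublocale nu: prob_space \<nu> by (rule prob_nu)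
sublocale mu_nu: pair_prob_space \<mu> \<nu> ..

lemma distr_nu: "distr \<nu> borel (\<lambda>p. (fst p, V p)) = P \<Otimes>\<^sub>M \<mu>"
  unfolding \<nu>_def
  by (subst distr_distr) (simp_all add: o_def split_beta' V_def distr_id2[OF sets_P_mu[symmetric]])

lemma distr_nu_fst: "distr \<nu> borel fst = P"
proof -
  have "distr \<nu> borel fst = distr (distr \<nu> borel (\<lambda>p. (fst p, V p))) borel fst"
    by (subst distr_distr) (simp_all add: o_def)
  also have "\<dots> = distr (P \<Otimes>\<^sub>M \<mu>) P fst"
    unfolding distr_nu by (rule distr_cong) simp_all
  finally show ?thesis by (simp add: mu.distr_pair_fst)
qed

lemma distr_nu_V: "distr \<nu> borel V = \<mu>"
proof -
  have "distr \<nu> borel V = distr (distr \<nu> borel (\<lambda>p. (fst p, V p))) borel snd"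
    by (subst distr_distr) (simp_all add: o_def)
  also have "\<dots> = distr (P \<Otimes>\<^sub>M \<mu>) \<mu> snd"
    unfolding distr_nu by (rule distr_cong) simp_all
  also have "\<dots> = \<mu>"
  proof (rule measure_eqI)
    fix A assume "A \<in> sets (distr (P \<Otimes>\<^sub>M \<mu>) \<mu> snd)"
    then have A: "A \<in> sets \<mu>" by simp
    then have "emeasure (distr (P \<Otimes>\<^sub>M \<mu>) \<mu> snd) A = emeasure (P \<Otimes>\<^sub>M \<mu>) (UNIV \<times> A)"
      by (subst emeasure_distr) (auto simp: space_pair_measure intro!: arg_cong[where f = "emeasure (P \<Otimes>\<^sub>M \<mu>)"])
    also have "\<dots> = emeasure \<mu> A"
      using A P.emeasure_space_1 by (subst mu.emeasure_pair_measure_Times) simp_all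
    finally show "emeasure (distr (P \<Otimes>\<^sub>M \<mu>) \<mu> snd) A = emeasure \<mu> A" .
  qed simp
  finally show ?thesis .
qed

lemma integrable_nu_fst: "integrable \<nu> (\<lambda>p. (norm (fst p))\<^sup>2)"
  using integrable_P by (subst (asm) distr_nu_fst[symmetric]) (simp add: integrable_distr_eq)

lemma integrable_nu_V: "integrable \<nu> (\<lambda>p. (norm (V p))\<^sup>2)"
  using integrable_mu by (subst (asm) distr_nu_V[symmetric]) (simp add: integrable_distr_eq)

lemma integrable_nu_snd: "integrable \<nu> (\<lambda>p. (norm (snd p))\<^sup>2)"
  unfolding decompose
  by (intro integrable_norm_sq_add integrable_norm_sq_linear[OF _ linear_R]
      integrable_norm_sq_linear[OF _ linear_L] integrable_nu_fst integrable_nu_V) simp_all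

lemma q_nonneg: "0 \<le> q w"
  using L_pos[of w] by (cases "w = 0") (auto simp: q_def less_imp_le linear_0[OF linear_L])

lemma q_le_norm:
  obtains C where "0 < C" "\<And>w. q w \<le> C * (norm w)\<^sup>2"
proof -
  obtain B where B: "0 < B" "\<And>x. norm (L x) \<le> B * norm x"
    using linear_bounded_pos[OF linear_L] by blast
  have "q w \<le> B * (norm w)\<^sup>2" for w
  proof -
    have "q w \<le> norm w * norm (L w)"
      unfolding q_def by (rule norm_cauchy_schwarz)
    also have "\<dots> \<le> norm w * (B * norm w)"
      by (intro mult_left_mono B) simp
    finally show ?thesis by (simp add: power2_eq_square mult_ac)
  qed
  with B(1) show thesis by (rule that)
qed

lemma norm_le_q:
  obtains c where "0 < c" "\<And>w. (norm w)\<^sup>2 \<le> c * q w"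
proof -
  have "continuous_on (sphere 0 1) q"
    unfolding q_def using linear_L
    by (intro continuous_intros linear_continuous_on) (simp add: linear_conv_bounded_linear)
  moreover have "sphere (0::'u) 1 \<noteq> {}" by simp
  ultimately obtain z where z: "norm z = 1" "\<And>w. norm w = 1 \<Longrightarrow> q z \<le> q w"
    using continuous_attains_inf[OF compact_sphere] by (metis mem_sphere_0)
  have qz: "0 < q z"
    unfolding q_def using z(1) by (intro L_pos) auto
  have "(norm w)\<^sup>2 \<le> (1 / q z) * q w" for w
  proof (cases "w = 0")
    case False
    have "q w = (norm w)\<^sup>2 * q (w /\<^sub>R norm w)"
      using False by (simp add: q_def linear_cmul[OF linear_L] power2_eq_square field_simps)
    also have "\<dots> \<ge> (norm w)\<^sup>2 * q z"
      using False z(2)[of "w /\<^sub>R norm w"] by (intro mult_left_mono) auto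
    finally show ?thesis
      using qz by (simp add: field_simps)
  qed (use qz q_nonneg in auto)
  with qz show thesis by (intro that[of "1 / q z"]) auto
qed

subsection \<open>The transport cost of a coupling\<close>

lemma couplingsD:
  assumes "\<pi> \<in> couplings \<mu> \<nu>"
  shows "prob_space \<pi>" "sets \<pi> = sets borel" "space \<pi> = UNIV"
    "distr \<pi> borel fst = \<mu>" "distr \<pi> borel snd = \<nu>"
  using assms sets_eq_imp_space_eq[of \<pi> borel] by (auto simp: couplings_def)

lemma integrable_fst_marginal:
  fixes f :: "'u \<Rightarrow> real"
  assumes p: "\<pi> \<in> couplings \<mu> \<nu>" and f: "integrable \<mu> f"
  shows "integrable \<pi> (\<lambda>w. f (fst w))"
proof -
  note [measurable_cong] = couplingsD(2)[OF p]
  show ?thesis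
    by (rule integrable_distr[of fst \<pi> borel]) (use f couplingsD(4)[OF p] in simp_all)
qed

lemma integrable_snd_marginal:
  fixes f :: "'x \<times> 'u \<Rightarrow> real"
  assumes p: "\<pi> \<in> couplings \<mu> \<nu>" and f: "integrable \<nu> f"
  shows "integrable \<pi> (\<lambda>w. f (snd w))"
proof -
  note [measurable_cong] = couplingsD(2)[OF p]
  show ?thesis
    by (rule integrable_distr[of snd \<pi> borel]) (use f couplingsD(5)[OF p] in simp_all)
qed

lemma integral_fst_marginal:
  fixes f :: "'u \<Rightarrow> real"
  assumes p: "\<pi> \<in> couplings \<mu> \<nu>" and f: "f \<in> borel_measurable borel"
  shows "(\<integral>w. f (fst w) \<partial>\<pi>) = (\<integral>u. f u \<partial>\<mu>)"
proof -
  note [measurable_cong] = couplingsD(2)[OF p]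
  show ?thesis
    using f by (subst couplingsD(4)[OF p, symmetric]) (rule integral_distr[symmetric], simp_all)
qed

lemma integral_snd_marginal:
  fixes f :: "'x \<times> 'u \<Rightarrow> real"
  assumes p: "\<pi> \<in> couplings \<mu> \<nu>" and f: "f \<in> borel_measurable borel"
  shows "(\<integral>w. f (snd w) \<partial>\<pi>) = (\<integral>u. f u \<partial>\<nu>)"
proof -
  note [measurable_cong] = couplingsD(2)[OF p]
  show ?thesis
    using f by (subst couplingsD(5)[OF p, symmetric]) (rule integral_distr[symmetric], simp_all)
qed

lemma coupling_integrable:
  assumes p: "\<pi> \<in> couplings \<mu> \<nu>"
  shows "integrable \<pi> (\<lambda>w. (norm (fst w))\<^sup>2)" "integrable \<pi> (\<lambda>w. (norm (fst (snd w)))\<^sup>2)"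
    "integrable \<pi> (\<lambda>w. (norm (snd (snd w)))\<^sup>2)" "integrable \<pi> (\<lambda>w. (norm (V (snd w)))\<^sup>2)"
    "integrable \<pi> (\<lambda>w. (norm (fst w - V (snd w)))\<^sup>2)"
    "integrable \<pi> (\<lambda>w. q (fst w - V (snd w)))"
    "integrable \<pi> (\<lambda>w. fst w \<bullet> R (fst (snd w)))"
    "integrable \<pi> (\<lambda>w. fst w \<bullet> L (V (snd w)))"
    "integrable \<pi> (\<lambda>w. (norm (fst w - snd (snd w)))\<^sup>2)"
proof -
  note [measurable_cong] = couplingsD(2)[OF p]
  note F = integrable_fst_marginal[OF p] and S = integrable_snd_marginal[OF p]
  have neg: "(norm (- w))\<^sup>2 = (norm w)\<^sup>2" for w :: 'u by simp
  show 1: "integrable \<pi> (\<lambda>w. (norm (fst w))\<^sup>2)"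
    by (rule F[OF integrable_mu])
  show 2: "integrable \<pi> (\<lambda>w. (norm (fst (snd w)))\<^sup>2)"
    by (rule S[OF integrable_nu_fst])
  show 3: "integrable \<pi> (\<lambda>w. (norm (snd (snd w)))\<^sup>2)"
    by (rule S[OF integrable_nu_snd])
  show 4: "integrable \<pi> (\<lambda>w. (norm (V (snd w)))\<^sup>2)"
    by (rule S[OF integrable_nu_V])
  show 5: "integrable \<pi> (\<lambda>w. (norm (fst w - V (snd w)))\<^sup>2)"
    unfolding diff_conv_add_uminus by (rule integrable_norm_sq_add) (use 1 4 in simp_all)
  show "integrable \<pi> (\<lambda>w. q (fst w - V (snd w)))"
    unfolding q_def
    by (intro integrable_inner_of_norm_sq 5 integrable_norm_sq_linear[OF _ linear_L]) simp_all
  show "integrable \<pi> (\<lambda>w. fst w \<bullet> R (fst (snd w)))"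
    by (intro integrable_inner_of_norm_sq 1 2 integrable_norm_sq_linear[OF _ linear_R]) simp_all
  show "integrable \<pi> (\<lambda>w. fst w \<bullet> L (V (snd w)))"
    by (intro integrable_inner_of_norm_sq 1 4 integrable_norm_sq_linear[OF _ linear_L]) simp_all
  show "integrable \<pi> (\<lambda>w. (norm (fst w - snd (snd w)))\<^sup>2)"
    unfolding diff_conv_add_uminus by (rule integrable_norm_sq_add) (use 1 3 in simp_all)
qed

text \<open>The part of \<open>E|U - Y|\<^sup>2\<close> that is determined by the marginals \<open>\<mu>\<close> and \<open>\<nu>\<close>.\<close>

definition cost0 :: real where
  "cost0 = (\<integral>u. (norm u)\<^sup>2 - 2 * (u \<bullet> m) - q u \<partial>\<mu>) + (\<integral>p. (norm (snd p))\<^sup>2 - q (V p) \<partial>\<nu>)"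

text \<open>With \<open>y = m + R x + L v\<close> one has
  \<open>|u - y|\<^sup>2 = (|u|\<^sup>2 - 2 u \<bullet> m - q u) + (|y|\<^sup>2 - q v) - 2 u \<bullet> R x + q (u - v)\<close>.\<close>

lemma cost_eq:
  assumes p: "\<pi> \<in> couplings \<mu> \<nu>" and ortho: "(\<integral>w. fst w \<bullet> R (fst (snd w)) \<partial>\<pi>) = 0"
  shows "(\<integral>w. (norm (fst w - snd (snd w)))\<^sup>2 \<partial>\<pi>) = cost0 + (\<integral>w. q (fst w - V (snd w)) \<partial>\<pi>)"
proof -
  define a where "a u = (norm u)\<^sup>2 - 2 * (u \<bullet> m) - q u" for u
  define b where "b p = (norm (snd p))\<^sup>2 - q (V p)" for p
  have am [measurable]: "a \<in> borel_measurable borel" and bm [measurable]: "b \<in> borel_measurable borel"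
    unfolding a_def b_def by measurable
  have a: "integrable \<mu> a"
    unfolding a_def q_def
    by (intro Bochner_Integration.integrable_diff integrable_mult_right integrable_mu
        integrable_inner_of_norm_sq integrable_norm_sq_linear[OF _ linear_L]) simp_all
  have b: "integrable \<nu> b"
    unfolding b_def q_def
    by (intro Bochner_Integration.integrable_diff integrable_nu_snd
        integrable_inner_of_norm_sq integrable_norm_sq_linear[OF _ linear_L] integrable_nu_V) simp_all
  have pointwise: "(norm (fst w - snd (snd w)))\<^sup>2 =
      a (fst w) + b (snd w) - 2 * (fst w \<bullet> R (fst (snd w))) + q (fst w - V (snd w))" for w
  proof -
    have "(norm (fst w - snd (snd w)))\<^sup>2 = (norm (fst w))\<^sup>2 - 2 * (fst w \<bullet> snd (snd w)) + (norm (snd (snd w)))\<^sup>2"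
      by (simp add: power2_norm_eq_inner inner_diff inner_commute)
    also have "fst w \<bullet> snd (snd w) = fst w \<bullet> m + fst w \<bullet> R (fst (snd w)) + fst w \<bullet> L (V (snd w))"
      by (subst decompose) (simp add: inner_add)
    finally have "(norm (fst w - snd (snd w)))\<^sup>2 = (norm (fst w))\<^sup>2 + (norm (snd (snd w)))\<^sup>2
        - 2 * (fst w \<bullet> m) - 2 * (fst w \<bullet> R (fst (snd w))) - 2 * (fst w \<bullet> L (V (snd w)))"
      by simp
    moreover have "2 * (fst w \<bullet> L (V (snd w))) = q (fst w) + q (V (snd w)) - q (fst w - V (snd w))"
      using L_sym[of "V (snd w)" "fst w"]
      by (simp add: q_def linear_diff[OF linear_L] inner_diff inner_commute)
    ultimately show ?thesis by (simp add: a_def b_def)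
  qed
  have "(\<integral>w. (norm (fst w - snd (snd w)))\<^sup>2 \<partial>\<pi>) = (\<integral>w. a (fst w) \<partial>\<pi>) + (\<integral>w. b (snd w) \<partial>\<pi>)
      - 2 * (\<integral>w. fst w \<bullet> R (fst (snd w)) \<partial>\<pi>) + (\<integral>w. q (fst w - V (snd w)) \<partial>\<pi>)"
    unfolding pointwise
    using coupling_integrable[OF p] integrable_fst_marginal[OF p a] integrable_snd_marginal[OF p b]
    by simp
  also have "(\<integral>w. a (fst w) \<partial>\<pi>) = (\<integral>u. a u \<partial>\<mu>)"
    by (rule integral_fst_marginal[OF p am])
  also have "(\<integral>w. b (snd w) \<partial>\<pi>) = (\<integral>p. b p \<partial>\<nu>)"
    by (rule integral_snd_marginal[OF p bm])
  finally show ?thesis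
    by (simp add: ortho cost0_def a_def b_def)
qed

text \<open>Both constraints on the coupling of \<open>U\<close> and \<open>X\<close> make the term \<open>u \<bullet> R x\<close> disappear in the mean.\<close>

lemma evqr_feasible_ortho:
  assumes "\<pi> \<in> evqr_feasible \<mu> \<nu>"
  shows "\<pi> \<in> couplings \<mu> \<nu>" "(\<integral>w. fst w \<bullet> R (fst (snd w)) \<partial>\<pi>) = 0"
proof -
  show p: "\<pi> \<in> couplings \<mu> \<nu>"
    using assms by (simp add: evqr_feasible_def)
  obtain K where K: "cond_law \<pi> K"
    and mean: "AE u in \<mu>. has_bochner_integral (K u) (\<lambda>(x, y). x) 0"
    using assms by (auto simp: evqr_feasible_def)
  define g where "g w = fst w \<bullet> R (fst (snd w))" for w :: "'u \<times> 'x \<times> 'u"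
  have gm [measurable]: "g \<in> borel_measurable borel"
    unfolding g_def by measurable
  have gi: "integrable \<pi> g"
    unfolding g_def by (rule coupling_integrable(7)[OF p])
  note dis = nn_integral_cond_law[OF K couplingsD(1,2)[OF p], unfolded couplingsD(4)[OF p]]
  \<comment> \<open>The positive and negative parts of \<open>g\<close> have equal integrals conditionally on \<open>u\<close>, hence also
    under \<open>\<pi>\<close>.\<close>
  have "AE u in \<mu>. (\<integral>\<^sup>+v. ennreal (g (u, v)) \<partial>K u) = (\<integral>\<^sup>+v. ennreal (- g (u, v)) \<partial>K u)"
    using mean
  proof eventually_elim
    case (elim u)
    have "has_bochner_integral (K u) (\<lambda>v. u \<bullet> R (fst v)) (u \<bullet> R 0)"
      using has_bochner_integral_bounded_linear[OF _ elim, of "\<lambda>x. u \<bullet> R x"] linear_R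
      by (simp add: split_beta' bounded_linear_inner_right_comp linear_conv_bounded_linear)
    then have i: "integrable (K u) (\<lambda>v. g (u, v))" and z: "(\<integral>v. g (u, v) \<partial>K u) = 0"
      by (auto simp: has_bochner_integral_iff g_def linear_0[OF linear_R])
    from i have fin: "(\<integral>\<^sup>+v. ennreal (g (u, v)) \<partial>K u) \<noteq> \<infinity>" "(\<integral>\<^sup>+v. ennreal (- g (u, v)) \<partial>K u) \<noteq> \<infinity>"
      by (simp_all add: real_integrable_def)
    have "enn2real (\<integral>\<^sup>+v. ennreal (g (u, v)) \<partial>K u) = enn2real (\<integral>\<^sup>+v. ennreal (- g (u, v)) \<partial>K u)"
      using z unfolding real_lebesgue_integral_def[OF i] by simp
    then show ?case
      using fin by (metis ennreal_enn2real infinity_ennreal_def top.not_eq_extremum)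
  qed
  then have "(\<integral>\<^sup>+w. ennreal (g w) \<partial>\<pi>) = (\<integral>\<^sup>+w. ennreal (- g w) \<partial>\<pi>)"
    by (subst (1 2) dis) (auto intro: nn_integral_cong_AE)
  then have "integral\<^sup>L \<pi> g = 0"
    unfolding real_lebesgue_integral_def[OF gi] by simp
  then show "(\<integral>w. fst w \<bullet> R (fst (snd w)) \<partial>\<pi>) = 0"
    by (simp add: g_def[abs_def])
qed

lemma indep_feasible_ortho:
  assumes "\<pi> \<in> indep_feasible \<mu> \<nu>"
  shows "\<pi> \<in> couplings \<mu> \<nu>" "(\<integral>w. fst w \<bullet> R (fst (snd w)) \<partial>\<pi>) = 0"
proof -
  show p: "\<pi> \<in> couplings \<mu> \<nu>"
    using assms by (simp add: indep_feasible_def)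
  note [measurable_cong] = couplingsD(2)[OF p] and sp = couplingsD(3)[OF p]
  interpret p: prob_space \<pi> by (rule couplingsD(1)[OF p])
  have indep: "p.indep_set (sets (vimage_algebra UNIV (\<lambda>(u, x, y). u) borel))
      (sets (vimage_algebra UNIV (\<lambda>(u, x, y). x) borel))"
    using assms by (simp add: indep_feasible_def sp)
  define J where "J w = (fst w, fst (snd w))" for w :: "'u \<times> 'x \<times> 'u"
  have Jm [measurable]: "J \<in> borel_measurable borel"
    unfolding J_def by measurable
  interpret mu_P: pair_prob_space \<mu> P ..
  have "\<mu> \<Otimes>\<^sub>M P = distr \<pi> borel J"
  proof (rule pair_measure_eqI)
    show "sets (\<mu> \<Otimes>\<^sub>M P) = sets (distr \<pi> borel J)"
      unfolding sets_distr borel_prod[symmetric] by (rule sets_pair_measure_cong[OF sets_mu sets_P])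
    fix A B assume A: "A \<in> sets \<mu>" and B: "B \<in> sets P"
    have [measurable]: "A \<in> sets borel" "B \<in> sets borel"
      using A B by auto
    let ?a = "(\<lambda>(u, x, y). u) -` A :: ('u \<times> 'x \<times> 'u) set" and ?b = "(\<lambda>(u, x, y). x) -` B :: ('u \<times> 'x \<times> 'u) set"
    have ab: "?a \<in> sets (vimage_algebra UNIV (\<lambda>(u, x, y). u) borel)"
      "?b \<in> sets (vimage_algebra UNIV (\<lambda>(u, x, y). x) borel)"
      using A B by (auto simp: sets_vimage_algebra2)
    have "emeasure \<mu> A = emeasure \<pi> ?a"
      by (subst couplingsD(4)[OF p, symmetric])
        (auto simp: emeasure_distr sp intro!: arg_cong[where f = "emeasure \<pi>"])
    moreover have "emeasure P B = emeasure \<pi> ?b"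
    proof -
      have "emeasure P B = emeasure \<nu> (fst -` B)"
        by (subst distr_nu_fst[symmetric]) (simp add: emeasure_distr)
      also have "\<dots> = emeasure \<pi> (snd -` (fst -` B))"
        by (subst couplingsD(5)[OF p, symmetric], subst emeasure_distr)
           (simp_all add: sp measurable_sets_borel[OF borel_fst])
      also have "snd -` (fst -` B) = ?b" by auto
      finally show ?thesis .
    qed
    moreover have "emeasure (distr \<pi> borel J) (A \<times> B) = emeasure \<pi> (?a \<inter> ?b)"
    proof -
      have "A \<times> B \<in> sets borel" by (simp flip: borel_prod)
      moreover have "J -` (A \<times> B) = ?a \<inter> ?b" by (auto simp: J_def)
      ultimately show ?thesis by (simp add: emeasure_distr sp)
    qed
    ultimately show "emeasure \<mu> A * emeasure P B = emeasure (distr \<pi> borel J) (A \<times> B)"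
      using p.indep_setD[OF indep ab] by (simp add: p.emeasure_eq_measure ennreal_mult)
  qed unfold_locales
  note J = this
  have gm: "(\<lambda>z. fst z \<bullet> R (snd z)) \<in> borel_measurable borel"
    by measurable
  have i: "integrable (\<mu> \<Otimes>\<^sub>M P) (\<lambda>z. fst z \<bullet> R (snd z))"
    unfolding J using coupling_integrable(7)[OF p] gm by (simp add: integrable_distr_eq J_def)
  have "(\<integral>w. fst w \<bullet> R (fst (snd w)) \<partial>\<pi>) = (\<integral>z. fst z \<bullet> R (snd z) \<partial>(\<mu> \<Otimes>\<^sub>M P))"
    unfolding J using gm by (simp add: integral_distr J_def)
  also have "\<dots> = (\<integral>u. \<integral>x. u \<bullet> R x \<partial>P \<partial>\<mu>)"
    using mu_P.integral_fst'[OF i] by simp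
  also have "\<dots> = (\<integral>u. 0 \<partial>\<mu>)"
  proof (rule Bochner_Integration.integral_cong[OF refl])
    fix u
    have "integrable P (\<lambda>x. x)"
      by (rule P.integrable_of_integrable_norm_sq[OF _ integrable_P]) simp
    then have "(\<integral>x. u \<bullet> R x \<partial>P) = u \<bullet> R (\<integral>x. x \<partial>P)"
      using linear_R by (intro integral_bounded_linear bounded_linear_inner_right_comp)
        (simp add: linear_conv_bounded_linear)
    then show "(\<integral>x. u \<bullet> R x \<partial>P) = 0"
      by (simp add: mean_P linear_0[OF linear_R])
  qed
  finally show "(\<integral>w. fst w \<bullet> R (fst (snd w)) \<partial>\<pi>) = 0" by simp
qed

subsection \<open>The coupling with \<open>U = V\<close>\<close>

lemma pi0_eq: "\<pi>0 = distr (P \<Otimes>\<^sub>M \<mu>) borel (\<lambda>(x, v). (v, x, m + R x + L v))"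
proof -
  have "(\<lambda>p. (V p, p)) \<circ> (\<lambda>(x, v). (x, m + R x + L v)) = (\<lambda>(x, v). (v, x, m + R x + L v))"
    by (auto simp: V_def)
  then show ?thesis
    unfolding \<pi>0_def \<nu>_def by (subst distr_distr) simp_all
qed

lemma sets_pi0 [simp, measurable_cong]: "sets \<pi>0 = sets borel" and space_pi0 [simp]: "space \<pi>0 = UNIV"
  by (simp_all add: \<pi>0_def)

lemma pi0_couplings: "\<pi>0 \<in> couplings \<mu> \<nu>"
proof -
  have "prob_space \<pi>0"
    unfolding \<pi>0_def by (rule nu.prob_space_distr) simp
  moreover have "distr \<pi>0 borel fst = \<mu>" "distr \<pi>0 borel snd = \<nu>"
    unfolding \<pi>0_def by (simp_all add: distr_distr o_def distr_nu_V distr_id2)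
  ultimately show ?thesis
    by (simp add: couplings_def)
qed

lemma AE_pi0: "AE w in \<pi>0. fst w = V (snd w)"
proof -
  have "{w :: 'u \<times> 'x \<times> 'u. fst w = V (snd w)} = {w. dist (fst w) (V (snd w)) = 0}"
    by simp
  also have "\<dots> \<in> sets borel"
    by measurable
  finally show ?thesis
    unfolding \<pi>0_def by (subst AE_distr_iff) simp_all
qed

lemma pi0_indep_feasible: "\<pi>0 \<in> indep_feasible \<mu> \<nu>"
proof -
  interpret p: prob_space \<pi>0 by (rule couplingsD(1)[OF pi0_couplings])
  let ?fu = "\<lambda>(u :: 'u, x :: 'x, y :: 'u). u" and ?fx = "\<lambda>(u :: 'u, x :: 'x, y :: 'u). x"
  let ?T = "\<lambda>(x, v). (v, x, m + R x + L v)"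
  have fu: "?fu \<in> borel_measurable borel" and fx: "?fx \<in> borel_measurable borel"
    and T: "?T \<in> borel_measurable borel"
    by (simp_all add: split_beta' borel_fst)
  have rect: "measure \<pi>0 (?fu -` A \<inter> ?fx -` B) = measure P B * measure \<mu> A"
    if A: "A \<in> sets borel" and B: "B \<in> sets borel" for A B
  proof -
    have "?fu -` A \<inter> ?fx -` B \<in> sets borel"
      using measurable_sets_borel[OF fu A] measurable_sets_borel[OF fx B] by auto
    then have "emeasure \<pi>0 (?fu -` A \<inter> ?fx -` B) = emeasure (P \<Otimes>\<^sub>M \<mu>) (B \<times> A)"
      unfolding pi0_eq using T
      by (subst emeasure_distr) (auto simp: space_pair_measure intro!: arg_cong[where f = "emeasure (P \<Otimes>\<^sub>M \<mu>)"])
    also have "\<dots> = emeasure P B * emeasure \<mu> A"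
      using A B by (subst mu.emeasure_pair_measure_Times) simp_all
    finally show ?thesis
      by (simp add: p.emeasure_eq_measure P.emeasure_eq_measure mu.emeasure_eq_measure
          flip: ennreal_mult)
  qed
  have "p.indep_set (sets (vimage_algebra UNIV ?fu borel)) (sets (vimage_algebra UNIV ?fx borel))"
  proof (rule p.indep_setI)
    show "sets (vimage_algebra UNIV ?fu borel) \<subseteq> p.events" "sets (vimage_algebra UNIV ?fx borel) \<subseteq> p.events"
      using measurable_sets_borel[OF fu] measurable_sets_borel[OF fx] by (auto simp: sets_vimage_algebra2)
    fix a b assume "a \<in> sets (vimage_algebra UNIV ?fu borel)" "b \<in> sets (vimage_algebra UNIV ?fx borel)"
    then obtain A B where "A \<in> sets borel" "B \<in> sets borel" and ab: "a = ?fu -` A" "b = ?fx -` B"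
      by (auto simp: sets_vimage_algebra2)
    then show "p.prob (a \<inter> b) = p.prob a * p.prob b"
      using rect[of A B] rect[of A UNIV] rect[of UNIV B]
      by (simp add: P.prob_space[simplified] mu.prob_space[simplified])
  qed
  then show ?thesis
    using pi0_couplings by (simp add: indep_feasible_def)
qed

lemma integral_q_pi0: "(\<integral>w. q (fst w - V (snd w)) \<partial>\<pi>0) = 0"
proof -
  have "(\<integral>w. q (fst w - V (snd w)) \<partial>\<pi>0) = (\<integral>w. 0 \<partial>\<pi>0)"
    using AE_pi0 by (intro integral_cong_AE) (auto simp: q_def)
  then show ?thesis by simp
qed

lemma nn_cost_eq:
  assumes p: "\<pi> \<in> couplings \<mu> \<nu>" and ortho: "(\<integral>w. fst w \<bullet> R (fst (snd w)) \<partial>\<pi>) = 0" and c: "0 \<le> c"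
  shows "(\<integral>\<^sup>+(u, x, y). ennreal (c * (norm (u - y))\<^sup>2) \<partial>\<pi>)
    = ennreal (c * (cost0 + (\<integral>w. q (fst w - V (snd w)) \<partial>\<pi>)))"
proof -
  have "(\<integral>\<^sup>+(u, x, y). ennreal (c * (norm (u - y))\<^sup>2) \<partial>\<pi>) = ennreal (\<integral>w. c * (norm (fst w - snd (snd w)))\<^sup>2 \<partial>\<pi>)"
    using coupling_integrable(9)[OF p] c by (subst nn_integral_eq_integral[symmetric]) (auto simp: split_beta')
  then show ?thesis
    by (simp add: cost_eq[OF p ortho])
qed

lemma integral_q_nonneg: "0 \<le> (\<integral>w. q (fst w - V (snd w)) \<partial>\<pi>)"
  by (simp add: q_nonneg)

lemma cost0_nonneg: "0 \<le> cost0"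
proof -
  have "cost0 = (\<integral>w. (norm (fst w - snd (snd w)))\<^sup>2 \<partial>\<pi>0)"
    using cost_eq[OF indep_feasible_ortho[OF pi0_indep_feasible]] by (simp add: integral_q_pi0)
  then show ?thesis by simp
qed

lemma pi0_optimal:
  "is_arg_min (\<lambda>\<rho>. \<integral>\<^sup>+(u, x, y). ennreal ((norm (u - y))\<^sup>2) \<partial>\<rho>) (\<lambda>\<rho>. \<rho> \<in> indep_feasible \<mu> \<nu>) \<pi>0"
  unfolding is_arg_min_linorder
proof (intro conjI allI impI)
  fix \<rho> assume r: "\<rho> \<in> indep_feasible \<mu> \<nu>"
  have *: "(\<integral>\<^sup>+(u, x, y). ennreal ((norm (u - y))\<^sup>2) \<partial>\<rho>) = ennreal (cost0 + (\<integral>w. q (fst w - V (snd w)) \<partial>\<rho>))"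
    if "\<rho> \<in> indep_feasible \<mu> \<nu>" for \<rho>
    using nn_cost_eq[OF indep_feasible_ortho[OF that], of 1] by simp
  show "(\<integral>\<^sup>+(u, x, y). ennreal ((norm (u - y))\<^sup>2) \<partial>\<pi>0) \<le> (\<integral>\<^sup>+(u, x, y). ennreal ((norm (u - y))\<^sup>2) \<partial>\<rho>)"
    unfolding *[OF r] *[OF pi0_indep_feasible] integral_q_pi0
    using integral_q_nonneg[of \<rho>] by (intro ennreal_leI) simp
qed (rule pi0_indep_feasible)

subsection \<open>Couplings of nearly optimal cost converge weakly\<close>

text \<open>Replacing \<open>u\<close> by \<open>V p\<close> changes \<open>f (u, p)\<close> by at most \<open>\<eta>\<close> when \<open>|p| < r\<close> and \<open>|u - V p| < d\<close>, by uniform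
  continuity on a compact set. Elsewhere the change is at most \<open>2 M\<close>, and one of the two quadratic
  terms is at least as large.\<close>

lemma test_function_bound:
  fixes f :: "'u \<times> 'x \<times> 'u \<Rightarrow> real"
  assumes f: "continuous_on UNIV f" and M: "\<And>w. \<bar>f w\<bar> \<le> M" and "0 < \<eta>" "0 < r"
  obtains d where "0 < d"
    "\<And>w. \<bar>f w - f (V (snd w), snd w)\<bar>
      \<le> \<eta> + 2 * M / r\<^sup>2 * (norm (snd w))\<^sup>2 + 2 * M / d\<^sup>2 * (norm (fst w - V (snd w)))\<^sup>2"
proof -
  define G where "G z = f (V (snd z) + fst z, snd z)" for z
  have V: "continuous_on UNIV V"
    unfolding V_def using linear_L' linear_R
    by (intro continuous_intros linear_continuous_on_compose[OF _ linear_L'] linear_continuous_on_compose[OF _ linear_R])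
  have "continuous_on UNIV G"
    unfolding G_def
    by (intro continuous_on_compose2[OF f] continuous_intros continuous_on_compose2[OF V]) auto
  then have "uniformly_continuous_on (cball 0 1 \<times> cball 0 r) G"
    by (intro compact_uniformly_continuous compact_Times compact_cball) (auto intro: continuous_on_subset)
  then obtain d0 where d0: "0 < d0" "\<And>z z'. z \<in> cball 0 1 \<times> cball 0 r \<Longrightarrow> z' \<in> cball 0 1 \<times> cball 0 r \<Longrightarrow>
      dist z' z < d0 \<Longrightarrow> dist (G z') (G z) < \<eta>"
    using \<open>0 < \<eta>\<close> unfolding uniformly_continuous_on_def by metis
  define d where "d = min d0 1"
  have d: "0 < d" "d \<le> 1" "d \<le> d0" using d0(1) by (auto simp: d_def)
  have M0: "0 \<le> M" using M[of 0] by (meson abs_ge_zero order_trans)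
  have "\<bar>f w - f (V (snd w), snd w)\<bar>
      \<le> \<eta> + 2 * M / r\<^sup>2 * (norm (snd w))\<^sup>2 + 2 * M / d\<^sup>2 * (norm (fst w - V (snd w)))\<^sup>2" for w
  proof -
    define a where "a = 2 * M / r\<^sup>2 * (norm (snd w))\<^sup>2"
    define b where "b = 2 * M / d\<^sup>2 * (norm (fst w - V (snd w)))\<^sup>2"
    have ab: "0 \<le> a" "0 \<le> b" using M0 by (simp_all add: a_def b_def)
    have le: "\<bar>f w - f (V (snd w), snd w)\<bar> \<le> 2 * M"
      using M[of w] M[of "(V (snd w), snd w)"] by linarith
    have large: "2 * M \<le> 2 * M / s\<^sup>2 * t\<^sup>2" if "0 < s" "s \<le> t" for s t :: real
    proof -
      have "s\<^sup>2 \<le> t\<^sup>2" using that by (intro power_mono) auto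
      then have "2 * M * s\<^sup>2 \<le> 2 * M * t\<^sup>2" using M0 by (intro mult_left_mono) auto
      then show ?thesis using that by (simp add: field_simps)
    qed
    consider "r \<le> norm (snd w)" | "d \<le> norm (fst w - V (snd w))"
      | "norm (snd w) < r" "norm (fst w - V (snd w)) < d" by linarith
    then have "\<bar>f w - f (V (snd w), snd w)\<bar> \<le> \<eta> + a + b"
    proof cases
      case 1
      then show ?thesis using large[OF \<open>0 < r\<close> 1] le ab \<open>0 < \<eta>\<close> unfolding a_def[symmetric] by linarith
    next
      case 2
      then show ?thesis using large[OF d(1) 2] le ab \<open>0 < \<eta>\<close> unfolding b_def[symmetric] by linarith
    next
      case 3
      have "dist (G (fst w - V (snd w), snd w)) (G (0, snd w)) < \<eta>"
        using 3 d by (intro d0(2)) (auto simp: dist_Pair_Pair)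
      then show ?thesis
        using ab by (simp add: G_def dist_real_def)
    qed
    then show ?thesis by (simp add: a_def b_def)
  qed
  with d(1) show thesis by (rule that)
qed

text \<open>Since \<open>(V, X, Y)\<close> has the law \<open>\<pi>0\<close> under every coupling, integrating the bound above gives weak
  convergence as soon as \<open>E q(U - V)\<close> tends to \<open>0\<close>.\<close>

lemma weakly_tendsto_pi0:
  assumes coup: "\<forall>\<^sub>F i in F. \<rho> i \<in> couplings \<mu> \<nu>"
    and conv: "((\<lambda>i. \<integral>w. q (fst w - V (snd w)) \<partial>\<rho> i) \<longlongrightarrow> 0) F"
  shows "weakly_tendsto \<rho> \<pi>0 F"
  unfolding weakly_tendsto_def
proof (intro allI impI)
  fix f :: "'u \<times> 'x \<times> 'u \<Rightarrow> real"
  assume f: "continuous_on UNIV f" and b: "bounded (range f)"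
  have fm [measurable]: "f \<in> borel_measurable borel"
    by (rule borel_measurable_continuous_onI[OF f])
  obtain M where M: "0 < M" "\<And>w. \<bar>f w\<bar> \<le> M"
    using b by (auto simp: bounded_pos)
  obtain c where c: "0 < c" "\<And>w. (norm w)\<^sup>2 \<le> c * q w"
    using norm_le_q by blast
  define S where "S = (\<integral>p. (norm p)\<^sup>2 \<partial>\<nu>)"
  have Si: "integrable \<nu> (\<lambda>p. (norm p)\<^sup>2)"
    using integrable_nu_fst integrable_nu_snd by (simp add: norm_prod_def)
  have S0: "0 \<le> S" by (simp add: S_def)
  show "((\<lambda>i. \<integral>w. f w \<partial>\<rho> i) \<longlongrightarrow> (\<integral>w. f w \<partial>\<pi>0)) F"
  proof (rule tendstoI)
    fix e :: real assume e: "0 < e"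
    \<comment> \<open>The radius makes the contribution \<open>2 M E|(X, Y)|\<^sup>2 / r\<^sup>2\<close> at most \<open>e / 4\<close>.\<close>
    define r where "r = sqrt (8 * M * (S + 1) / e)"
    have pos: "0 < 8 * M * (S + 1) / e"
      using e M(1) S0 by simp
    then have r: "0 < r" and rr: "r\<^sup>2 = 8 * M * (S + 1) / e"
      by (simp_all add: r_def)
    have "2 * M / r\<^sup>2 * S = e / 4 * (S / (S + 1))"
      unfolding rr using e M(1) S0 by (simp add: divide_simps)
    also have "\<dots> \<le> e / 4 * 1"
      using e S0 by (intro mult_left_mono) auto
    finally have r2: "2 * M / r\<^sup>2 * S \<le> e / 4" by simp
    have "0 < e / 4" using e by simp
    obtain d where d: "0 < d" and bound: "\<And>w. \<bar>f w - f (V (snd w), snd w)\<bar>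
      \<le> e / 4 + 2 * M / r\<^sup>2 * (norm (snd w))\<^sup>2 + 2 * M / d\<^sup>2 * (norm (fst w - V (snd w)))\<^sup>2"
      using test_function_bound[OF f M(2) \<open>0 < e / 4\<close> r] by metis
    define k where "k = 2 * M / d\<^sup>2 * c"
    have k: "0 < k" using M(1) c(1) d by (simp add: k_def)
    have "\<forall>\<^sub>F i in F. (\<integral>w. q (fst w - V (snd w)) \<partial>\<rho> i) < e / (4 * k)"
      using conv e k by (intro order_tendstoD(2)[OF conv]) simp
    with coup show "\<forall>\<^sub>F i in F. dist (\<integral>w. f w \<partial>\<rho> i) (\<integral>w. f w \<partial>\<pi>0) < e"
    proof eventually_elim
      case (elim i)
      note p = elim(1)
      interpret p: prob_space "\<rho> i" by (rule couplingsD(1)[OF p])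
      note [measurable_cong] = couplingsD(2)[OF p]
      have i1: "integrable (\<rho> i) f"
        using M(2) by (intro p.integrable_const_bound[where B = M]) auto
      have i2: "integrable (\<rho> i) (\<lambda>w. f (V (snd w), snd w))"
        using M(2) by (intro p.integrable_const_bound[where B = M]) auto
      have "(\<integral>w. f w \<partial>\<pi>0) = (\<integral>p. f (V p, p) \<partial>\<nu>)"
        unfolding \<pi>0_def by (simp add: integral_distr)
      also have "\<dots> = (\<integral>w. f (V (snd w), snd w) \<partial>\<rho> i)"
        by (rule integral_snd_marginal[OF p, symmetric]) simp
      finally have "dist (\<integral>w. f w \<partial>\<rho> i) (\<integral>w. f w \<partial>\<pi>0) = \<bar>\<integral>w. f w - f (V (snd w), snd w) \<partial>\<rho> i\<bar>"
        using i1 i2 by (simp add: dist_real_def)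
      also have "\<dots> \<le> (\<integral>w. \<bar>f w - f (V (snd w), snd w)\<bar> \<partial>\<rho> i)"
        by (rule integral_abs_bound)
      also have "\<dots> \<le> (\<integral>w. e / 4 + 2 * M / r\<^sup>2 * (norm (snd w))\<^sup>2 + k * q (fst w - V (snd w)) \<partial>\<rho> i)"
      proof (rule integral_mono)
        show "integrable (\<rho> i) (\<lambda>w. \<bar>f w - f (V (snd w), snd w)\<bar>)"
          using i1 i2 by auto
        show "integrable (\<rho> i) (\<lambda>w. e / 4 + 2 * M / r\<^sup>2 * (norm (snd w))\<^sup>2 + k * q (fst w - V (snd w)))"
          using integrable_snd_marginal[OF p Si] coupling_integrable(6)[OF p] by auto
        fix w
        have "2 * M / d\<^sup>2 * (norm (fst w - V (snd w)))\<^sup>2 \<le> 2 * M / d\<^sup>2 * (c * q (fst w - V (snd w)))"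
          using M(1) by (intro mult_left_mono c) simp
        then show "\<bar>f w - f (V (snd w), snd w)\<bar> \<le> e / 4 + 2 * M / r\<^sup>2 * (norm (snd w))\<^sup>2 + k * q (fst w - V (snd w))"
          using bound[of w] by (simp add: k_def mult.assoc)
      qed
      also have "\<dots> = e / 4 + 2 * M / r\<^sup>2 * S + k * (\<integral>w. q (fst w - V (snd w)) \<partial>\<rho> i)"
        using integrable_snd_marginal[OF p Si] coupling_integrable(6)[OF p]
          integral_snd_marginal[OF p, of "\<lambda>p. (norm p)\<^sup>2"]
        by (simp add: S_def p.prob_space)
      also have "\<dots> < e / 4 + e / 4 + e / 4"
      proof -
        have "k * (\<integral>w. q (fst w - V (snd w)) \<partial>\<rho> i) < e / 4"
          using elim(2) k by (simp add: field_simps)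
        then show ?thesis using r2 by linarith
      qed
      also have "\<dots> \<le> e" using e by simp
      finally show ?case .
    qed
  qed
qed

subsection \<open>Competitors of finite entropy\<close>

lemma simple_approximation:
  assumes "0 < \<eta>"
  obtains s :: "'u \<Rightarrow> 'u" where "simple_function \<mu> s" "integrable \<mu> (\<lambda>u. (norm (u - s u))\<^sup>2)"
    "(\<integral>u. (norm (u - s u))\<^sup>2 \<partial>\<mu>) < \<eta>"
proof -
  obtain F where F: "\<And>i. simple_function \<mu> (F i)" "\<And>u. (\<lambda>i. F i u) \<longlonglongrightarrow> u"
    and dist: "\<And>i u. dist (F i u) 0 \<le> 2 * dist u 0"
    using borel_measurable_implies_sequence_metric[of "\<lambda>u. u" \<mu> 0] by auto
  have [measurable]: "F i \<in> borel_measurable \<mu>" for i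
    by (rule borel_measurable_simple_function[OF F(1)])
  have bound: "norm ((norm (u - F i u))\<^sup>2) \<le> 9 * (norm u)\<^sup>2" for i u
  proof -
    have "norm (u - F i u) \<le> norm u + norm (F i u)"
      by (rule norm_triangle_ineq4)
    also have "\<dots> \<le> 3 * norm u"
      using dist[of i u] by simp
    finally have "(norm (u - F i u))\<^sup>2 \<le> (3 * norm u)\<^sup>2"
      by (intro power_mono) auto
    then show ?thesis by (simp add: power_mult_distrib)
  qed
  have w: "integrable \<mu> (\<lambda>u. 9 * (norm u)\<^sup>2)"
    using integrable_mu by simp
  have i: "integrable \<mu> (\<lambda>u. (norm (u - F i u))\<^sup>2)" for i
    by (rule Bochner_Integration.integrable_bound[OF w]) (use bound[of _ i] in \<open>auto intro!: AE_I2\<close>)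
  have "(\<lambda>i. (norm (u - F i u))\<^sup>2) \<longlonglongrightarrow> 0" for u
  proof -
    have "(\<lambda>i. (norm (u - F i u))\<^sup>2) \<longlonglongrightarrow> (norm (u - u))\<^sup>2"
      by (intro tendsto_intros F(2))
    then show ?thesis by simp
  qed
  then have "(\<lambda>i. \<integral>u. (norm (u - F i u))\<^sup>2 \<partial>\<mu>) \<longlonglongrightarrow> (\<integral>u. 0 \<partial>\<mu>)"
    using bound by (intro integral_dominated_convergence[OF _ _ w]) (auto intro!: AE_I2)
  then have "\<forall>\<^sub>F i in sequentially. (\<integral>u. (norm (u - F i u))\<^sup>2 \<partial>\<mu>) < \<eta>"
    using assms by (intro order_tendstoD(2)) auto
  then obtain i0 where "(\<integral>u. (norm (u - F i0 u))\<^sup>2 \<partial>\<mu>) < \<eta>"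
    by (auto simp: eventually_sequentially)
  with F(1) i show thesis by (intro that)
qed

text \<open>The density, with respect to \<open>\<mu> \<otimes> \<mu>\<close>, of the coupling that makes \<open>U\<close> and \<open>V\<close> conditionally
  independent given that they lie in the same fibre of \<open>s\<close>. On the fibres of measure zero the
  value \<open>1\<close> keeps every section \<open>f u\<close> a probability density.\<close>

lemma block_density:
  fixes s :: "'u \<Rightarrow> 'u"
  assumes s: "simple_function \<mu> s"
  obtains f :: "'u \<Rightarrow> 'u \<Rightarrow> real" and B where
    "(\<lambda>w. f (fst w) (snd w)) \<in> borel_measurable borel"
    "\<And>u v. f u v = 0 \<or> 1 \<le> f u v" "\<And>u v. f u v \<le> B"
    "\<And>u. (\<integral>\<^sup>+v. ennreal (f u v) \<partial>\<mu>) = 1" "AE v in \<mu>. (\<integral>\<^sup>+u. ennreal (f u v) \<partial>\<mu>) = 1"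
    "AE u in \<mu>. \<forall>v. f u v \<noteq> 0 \<longrightarrow> s v = s u"
proof -
  define c where "c y = measure \<mu> (s -` {y})" for y
  define f where "f u v = (if c (s u) = 0 then 1 else if s v = s u then 1 / c (s u) else 0)" for u v
  define B where "B = 1 + (\<Sum>y\<in>range s. 1 / c y)"
  have sm [measurable]: "s \<in> borel_measurable borel"
    using borel_measurable_simple_function[OF s] by simp
  have fin: "finite (range s)"
    using simple_functionD(1)[OF s] by simp
  have cell [measurable]: "s -` {y} \<in> sets borel" for y
    using simple_functionD(2)[OF s, of "{y}"] by simp
  have "simple_function \<mu> (\<lambda>u. c (s u))"
    by (rule simple_function_compose1[OF s])
  then have cm [measurable]: "(\<lambda>u. c (s u)) \<in> borel_measurable borel"
    using borel_measurable_simple_function by fastforce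
  have c01: "0 \<le> c y" "c y \<le> 1" for y
    by (simp_all add: c_def)
  have em: "emeasure \<mu> (s -` {y}) = ennreal (c y)" for y
    by (simp add: c_def mu.emeasure_eq_measure)
  have cpos: "AE u in \<mu>. c (s u) \<noteq> 0"
  proof -
    have "AE u in \<mu>. \<forall>y\<in>range s. c y = 0 \<longrightarrow> s u \<noteq> y"
    proof (rule AE_finite_allI[OF fin])
      fix y
      show "AE u in \<mu>. c y = 0 \<longrightarrow> s u \<noteq> y"
      proof (cases "c y = 0")
        case True
        then have "s -` {y} \<in> null_sets \<mu>"
          by (simp add: null_sets_def em)
        then show ?thesis
          using AE_not_in by fastforce
      qed simp
    qed
    then show ?thesis by eventually_elim auto
  qed
  have cell_int: "(\<integral>\<^sup>+u. ennreal (1 / c y) * indicator (s -` {y}) u \<partial>\<mu>) = 1" if "c y \<noteq> 0" for y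
  proof -
    have "(\<integral>\<^sup>+u. ennreal (1 / c y) * indicator (s -` {y}) u \<partial>\<mu>) = ennreal (1 / c y) * ennreal (c y)"
      by (simp add: nn_integral_cmult em)
    also have "\<dots> = 1"
      using c01[of y] that by (simp flip: ennreal_mult)
    finally show ?thesis .
  qed
  show thesis
  proof (rule that)
    show "(\<lambda>w. f (fst w) (snd w)) \<in> borel_measurable borel"
    proof -
      have "(\<lambda>w. f (fst w) (snd w)) = (\<lambda>w. if c (s (fst w)) = 0 then 1
          else if dist (s (snd w)) (s (fst w)) = 0 then 1 / c (s (fst w)) else 0)"
        by (auto simp: f_def)
      also have "\<dots> \<in> borel_measurable borel"
        using measurable_compose[OF borel_fst cm] by measurable
      finally show ?thesis .
    qed
    show "f u v = 0 \<or> 1 \<le> f u v" for u v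
      using c01[of "s u"] by (auto simp: f_def)
    show "f u v \<le> B" for u v
    proof -
      have "1 / c (s u) \<le> (\<Sum>y\<in>range s. 1 / c y)"
        using fin c01 by (intro member_le_sum) auto
      moreover have "0 \<le> (\<Sum>y\<in>range s. 1 / c y)"
        using c01 by (intro sum_nonneg) auto
      ultimately show ?thesis by (auto simp: f_def B_def)
    qed
    show "(\<integral>\<^sup>+v. ennreal (f u v) \<partial>\<mu>) = 1" for u
    proof (cases "c (s u) = 0")
      case True
      then show ?thesis by (simp add: f_def mu.emeasure_space_1[simplified])
    next
      case False
      then have "ennreal (f u v) = ennreal (1 / c (s u)) * indicator (s -` {s u}) v" for v
        by (simp add: f_def indicator_def)
      then show ?thesis using cell_int[OF False] by simp
    qed
    show "AE v in \<mu>. (\<integral>\<^sup>+u. ennreal (f u v) \<partial>\<mu>) = 1"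
      using cpos
    proof eventually_elim
      case (elim v)
      have "(\<integral>\<^sup>+u. ennreal (f u v) \<partial>\<mu>) = (\<integral>\<^sup>+u. ennreal (1 / c (s v)) * indicator (s -` {s v}) u \<partial>\<mu>)"
        using cpos by (intro nn_integral_cong_AE, eventually_elim) (auto simp: f_def indicator_def)
      then show ?case using cell_int[OF elim] by simp
    qed
    show "AE u in \<mu>. \<forall>v. f u v \<noteq> 0 \<longrightarrow> s v = s u"
      using cpos by eventually_elim (auto simp: f_def)
  qed
qed

lemma nn_integral_nu_V: "h \<in> borel_measurable borel \<Longrightarrow> (\<integral>\<^sup>+p. h (V p) \<partial>\<nu>) = (\<integral>\<^sup>+v. h v \<partial>\<mu>)"
  by (subst distr_nu_V[symmetric]) (simp add: nn_integral_distr)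

lemma sets_mu_nu [simp, measurable_cong]: "sets (\<mu> \<Otimes>\<^sub>M \<nu>) = sets borel"
  by (rule trans[OF sets_pair_measure_cong[OF sets_mu sets_nu] arg_cong[where f = sets, OF borel_prod]])

text \<open>The block density \<open>f\<close>, evaluated at \<open>(u, V p)\<close>, is the density with respect to \<open>\<mu> \<otimes> \<nu>\<close> of a coupling.
  It leaves the law of \<open>X\<close> given \<open>U\<close> unchanged, so the mean constraint holds; its entropy is finite
  because \<open>f\<close> is bounded; and \<open>U - V = (U - s U) - (V - s V)\<close> holds almost surely.\<close>

lemma competitor:
  assumes \<eta>: "0 < \<eta>"
  obtains \<rho> k where "\<rho> \<in> evqr_feasible \<mu> \<nu>" "KL \<rho> (\<mu> \<Otimes>\<^sub>M \<nu>) = ereal k"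
    "(\<integral>w. q (fst w - V (snd w)) \<partial>\<rho>) \<le> \<eta>"
proof -
  obtain C where C: "0 < C" "\<And>w. q w \<le> C * (norm w)\<^sup>2"
    using q_le_norm by blast
  \<comment> \<open>The bound \<open>q \<le> C |\<cdot>|\<^sup>2\<close> and \<open>|a - b|\<^sup>2 \<le> 2 |a|\<^sup>2 + 2 |b|\<^sup>2\<close>, applied to two variables of law \<open>\<mu>\<close>, produce
    the factor \<open>4 C\<close>.\<close>
  obtain s where s: "simple_function \<mu> s" and si: "integrable \<mu> (\<lambda>u. (norm (u - s u))\<^sup>2)"
    and s\<eta>: "(\<integral>u. (norm (u - s u))\<^sup>2 \<partial>\<mu>) < \<eta> / (4 * C)"
    using simple_approximation[of "\<eta> / (4 * C)"] \<eta> C(1) by auto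
  obtain f B where fm: "(\<lambda>w. f (fst w) (snd w)) \<in> borel_measurable borel"
    and f01: "\<And>u v. f u v = 0 \<or> (1::real) \<le> f u v" and fB: "\<And>u v. f u v \<le> B"
    and int_v: "\<And>u. (\<integral>\<^sup>+v. ennreal (f u v) \<partial>\<mu>) = 1"
    and int_u: "AE v in \<mu>. (\<integral>\<^sup>+u. ennreal (f u v) \<partial>\<mu>) = 1"
    and fs: "AE u in \<mu>. \<forall>v. f u v \<noteq> 0 \<longrightarrow> s v = s u"
    using block_density[OF s] by blast
  have sm [measurable]: "s \<in> borel_measurable borel"
    using borel_measurable_simple_function[OF s] by simp
  have f0: "0 \<le> f u v" for u v
    using f01[of u v] by auto
  have fum [measurable]: "f u \<in> borel_measurable borel" for u
    using measurable_compose[OF _ fm, of "\<lambda>v. (u, v)" borel] by simp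
  have fvm [measurable]: "(\<lambda>u. f u v) \<in> borel_measurable borel" for v
    using measurable_compose[OF _ fm, of "\<lambda>u. (u, v)" borel] by simp
  define g where "g w = f (fst w) (V (snd w))" for w :: "'u \<times> 'x \<times> 'u"
  have gm [measurable]: "g \<in> borel_measurable borel"
    unfolding g_def using measurable_compose[OF _ fm, of "\<lambda>w. (fst w, V (snd w))" borel] by simp
  define \<rho> where "\<rho> = density (\<mu> \<Otimes>\<^sub>M \<nu>) g"
  have rs [simp, measurable_cong]: "sets \<rho> = sets borel"
    unfolding \<rho>_def sets_density by (rule sets_mu_nu)
  have rsp [simp]: "space \<rho> = UNIV"
    by (simp add: \<rho>_def space_pair_measure)
  have nn: "(\<integral>\<^sup>+w. h w \<partial>\<rho>) = (\<integral>\<^sup>+u. \<integral>\<^sup>+p. ennreal (f u (V p)) * h (u, p) \<partial>\<nu> \<partial>\<mu>)"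
    if [measurable]: "h \<in> borel_measurable borel" for h
  proof -
    have "(\<integral>\<^sup>+w. h w \<partial>\<rho>) = (\<integral>\<^sup>+w. ennreal (g w) * h w \<partial>(\<mu> \<Otimes>\<^sub>M \<nu>))"
      unfolding \<rho>_def by (rule nn_integral_density) measurable
    also have "\<dots> = (\<integral>\<^sup>+u. \<integral>\<^sup>+p. ennreal (g (u, p)) * h (u, p) \<partial>\<nu> \<partial>\<mu>)"
      by (rule nu.nn_integral_fst[symmetric]) measurable
    finally show ?thesis by (simp add: g_def)
  qed
  have int_p: "(\<integral>\<^sup>+p. ennreal (f u (V p)) \<partial>\<nu>) = 1" for u
    using nn_integral_nu_V[of "\<lambda>v. ennreal (f u v)"] int_v by simp
  have fstm: "distr \<rho> borel fst = \<mu>"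
  proof (rule measure_eqI)
    fix A assume "A \<in> sets (distr \<rho> borel fst)"
    then have [measurable]: "A \<in> sets borel" by simp
    have "emeasure (distr \<rho> borel fst) A = (\<integral>\<^sup>+z. indicator A z \<partial>distr \<rho> borel fst)"
      by simp
    also have "\<dots> = (\<integral>\<^sup>+w. indicator A (fst w) \<partial>\<rho>)"
      by (rule nn_integral_distr) measurable
    also have "\<dots> = (\<integral>\<^sup>+u. indicator A u \<partial>\<mu>)"
      by (subst nn) (simp_all add: nn_integral_multc int_p)
    finally show "emeasure (distr \<rho> borel fst) A = emeasure \<mu> A" by simp
  qed simp
  have prob: "prob_space \<rho>"
  proof (rule prob_spaceI)
    show "emeasure \<rho> (space \<rho>) = 1"
      using arg_cong[OF fstm, of "\<lambda>M. emeasure M UNIV"] mu.emeasure_space_1 by (simp add: emeasure_distr)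
  qed
  have int_u': "AE p in \<nu>. (\<integral>\<^sup>+u. ennreal (f u (V p)) \<partial>\<mu>) = 1"
    by (rule AE_distrD[of V \<nu> borel], simp, subst distr_nu_V, rule int_u)
  have sndm: "distr \<rho> borel snd = \<nu>"
  proof (rule measure_eqI)
    fix A assume "A \<in> sets (distr \<rho> borel snd)"
    then have [measurable]: "A \<in> sets borel" by simp
    have "emeasure (distr \<rho> borel snd) A = (\<integral>\<^sup>+z. indicator A z \<partial>distr \<rho> borel snd)"
      by simp
    also have "\<dots> = (\<integral>\<^sup>+w. indicator A (snd w) \<partial>\<rho>)"
      by (rule nn_integral_distr) measurable
    also have "\<dots> = (\<integral>\<^sup>+u. \<integral>\<^sup>+p. ennreal (f u (V p)) * indicator A p \<partial>\<nu> \<partial>\<mu>)"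
      by (subst nn) simp_all
    also have "\<dots> = (\<integral>\<^sup>+p. \<integral>\<^sup>+u. ennreal (f u (V p)) * indicator A p \<partial>\<mu> \<partial>\<nu>)"
    proof -
      have "(\<lambda>(u, p). ennreal (g (u, p)) * indicator A p) \<in> borel_measurable (\<mu> \<Otimes>\<^sub>M \<nu>)"
        by measurable
      from mu_nu.Fubini'[OF this] show ?thesis
        by (simp add: g_def)
    qed
    also have "\<dots> = (\<integral>\<^sup>+p. indicator A p \<partial>\<nu>)"
      using int_u' by (intro nn_integral_cong_AE, eventually_elim) (simp add: nn_integral_multc)
    finally show "emeasure (distr \<rho> borel snd) A = emeasure \<nu> A" by simp
  qed simp
  have coup: "\<rho> \<in> couplings \<mu> \<nu>"
    by (simp add: couplings_def prob fstm sndm)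
  define K where "K u = density \<nu> (\<lambda>p. ennreal (f u (V p)))" for u
  have cond: "cond_law \<rho> K"
    unfolding cond_law_def
  proof (intro conjI ballI)
    have Kp: "prob_space (K u)" for u
      by (rule prob_spaceI) (simp add: K_def emeasure_density int_p)
    show "K \<in> borel \<rightarrow>\<^sub>M prob_algebra borel"
    proof (rule measurable_prob_algebraI[OF Kp], rule measurable_subprob_algebra)
      show "subprob_space (K u)" for u
        by (rule prob_space_imp_subprob_space[OF Kp])
      show "sets (K u) = sets borel" for u
        by (simp add: K_def)
      show "(\<lambda>u. emeasure (K u) A) \<in> borel_measurable borel" if [measurable]: "A \<in> sets borel" for A
      proof -
        have "(\<lambda>u. \<integral>\<^sup>+p. ennreal (g (u, p)) * indicator A p \<partial>\<nu>) \<in> borel_measurable \<mu>"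
          by (rule nu.borel_measurable_nn_integral) simp
        then show ?thesis
          by (simp add: K_def emeasure_density g_def)
      qed
    qed
    fix A :: "'u set" and D :: "('x \<times> 'u) set"
    assume [measurable]: "A \<in> sets borel" "D \<in> sets borel"
    have AD: "A \<times> D \<in> sets borel" by (intro borel_Times) fact+
    have "emeasure \<rho> (A \<times> D) = (\<integral>\<^sup>+w. indicator (A \<times> D) w \<partial>\<rho>)"
      using AD by simp
    also have "\<dots> = (\<integral>\<^sup>+u. \<integral>\<^sup>+p. ennreal (f u (V p)) * indicator (A \<times> D) (u, p) \<partial>\<nu> \<partial>\<mu>)"
      using AD by (intro nn) simp
    also have "\<dots> = (\<integral>\<^sup>+u\<in>A. emeasure (K u) D \<partial>\<mu>)"
      by (intro nn_integral_cong) (auto simp: K_def emeasure_density indicator_times split: split_indicator)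
    finally show "emeasure \<rho> (A \<times> D) = (\<integral>\<^sup>+u\<in>A. emeasure (K u) D \<partial>distr \<rho> borel fst)"
      by (simp add: fstm)
  qed
  have mean: "has_bochner_integral (K u) (\<lambda>(x, y). x) 0" for u
  proof -
    have xi: "integrable P (\<lambda>x. x)"
      by (rule P.integrable_of_integrable_norm_sq[OF _ integrable_P]) simp
    have hm: "(\<lambda>z. f u (snd z) *\<^sub>R fst z) \<in> borel_measurable (P \<Otimes>\<^sub>M \<mu>)"
      by measurable
    have i: "integrable (P \<Otimes>\<^sub>M \<mu>) (\<lambda>z. f u (snd z) *\<^sub>R fst z)"
    proof (rule Bochner_Integration.integrable_bound[OF _ hm])
      have "integrable (P \<Otimes>\<^sub>M \<mu>) (\<lambda>z. fst z)"
      proof -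
        have "distr (P \<Otimes>\<^sub>M \<mu>) P fst = P"
          by (rule mu.distr_pair_fst)
        then show ?thesis
          using xi by (intro integrable_distr[of fst "P \<Otimes>\<^sub>M \<mu>" P "\<lambda>x. x"]) simp_all
      qed
      then show "integrable (P \<Otimes>\<^sub>M \<mu>) (\<lambda>z. B *\<^sub>R fst z)" by simp
      have "norm (f u v *\<^sub>R x) \<le> norm (B *\<^sub>R x)" for v and x :: 'x
        using f0[of u v] fB[of u v] by (auto intro!: mult_right_mono)
      then show "AE z in P \<Otimes>\<^sub>M \<mu>. norm (f u (snd z) *\<^sub>R fst z) \<le> norm (B *\<^sub>R fst z)"
        by auto
    qed
    have z: "(\<integral>z. f u (snd z) *\<^sub>R fst z \<partial>(P \<Otimes>\<^sub>M \<mu>)) = 0"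
    proof -
      have "(\<integral>z. f u (snd z) *\<^sub>R fst z \<partial>(P \<Otimes>\<^sub>M \<mu>)) = (\<integral>v. \<integral>x. f u v *\<^sub>R x \<partial>P \<partial>\<mu>)"
        using P_mu.integral_snd[of "\<lambda>x v. f u v *\<^sub>R x"] i by (simp add: split_beta')
      then show ?thesis by (simp add: mean_P)
    qed
    have "has_bochner_integral (distr \<nu> borel (\<lambda>p. (fst p, V p))) (\<lambda>z. f u (snd z) *\<^sub>R fst z) 0"
      unfolding distr_nu using i z by (simp add: has_bochner_integral_iff)
    then have "has_bochner_integral \<nu> (\<lambda>p. f u (V p) *\<^sub>R fst p) 0"
      by (simp add: has_bochner_integral_iff integrable_distr_eq integral_distr)
    then show ?thesis
      unfolding K_def using f0 by (intro has_bochner_integral_density) (simp_all add: split_beta')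
  qed
  have feas: "\<rho> \<in> evqr_feasible \<mu> \<nu>"
    using coup cond mean by (auto simp: evqr_feasible_def)
  obtain k where k: "KL \<rho> (\<mu> \<Otimes>\<^sub>M \<nu>) = ereal k"
    unfolding \<rho>_def
    by (rule KL_density_bounded[of "\<mu> \<Otimes>\<^sub>M \<nu>" g B])
       (use prob f01 fB mu_nu.prob_space_axioms in \<open>auto simp: g_def \<rho>_def\<close>)
  have same: "AE w in \<rho>. s (V (snd w)) = s (fst w)"
  proof -
    have "AE w in \<rho>. \<forall>v. f (fst w) v \<noteq> 0 \<longrightarrow> s v = s (fst w)"
      by (rule AE_distrD[of fst \<rho> borel], measurable, subst fstm, rule fs)
    moreover have "AE w in \<rho>. g w \<noteq> 0"
      unfolding \<rho>_def by (subst AE_density) auto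
    ultimately show ?thesis
      by eventually_elim (simp add: g_def)
  qed
  define a where "a u = (norm (u - s u))\<^sup>2" for u
  have am [measurable]: "a \<in> borel_measurable borel"
    unfolding a_def by measurable
  have ai: "integrable \<mu> a"
    using si by (simp add: a_def[abs_def])
  have aV: "integrable \<nu> (\<lambda>p. a (V p))" "(\<integral>p. a (V p) \<partial>\<nu>) = (\<integral>u. a u \<partial>\<mu>)"
  proof -
    show "integrable \<nu> (\<lambda>p. a (V p))"
      using ai by (intro integrable_distr[of V \<nu> borel a]) (simp_all add: distr_nu_V)
    show "(\<integral>p. a (V p) \<partial>\<nu>) = (\<integral>u. a u \<partial>\<mu>)"
      by (subst distr_nu_V[symmetric]) (simp add: integral_distr)
  qed
  have "(\<integral>w. q (fst w - V (snd w)) \<partial>\<rho>) \<le> (\<integral>w. 2 * C * (a (fst w) + a (V (snd w))) \<partial>\<rho>)"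
  proof (rule integral_mono_AE)
    show "integrable \<rho> (\<lambda>w. q (fst w - V (snd w)))"
      by (rule coupling_integrable(6)[OF coup])
    show "integrable \<rho> (\<lambda>w. 2 * C * (a (fst w) + a (V (snd w))))"
      using integrable_fst_marginal[OF coup ai] integrable_snd_marginal[OF coup aV(1)] by simp
    show "AE w in \<rho>. q (fst w - V (snd w)) \<le> 2 * C * (a (fst w) + a (V (snd w)))"
      using same
    proof eventually_elim
      case (elim w)
      let ?x = "fst w - s (fst w)" and ?y = "V (snd w) - s (V (snd w))"
      have "(norm (?x - ?y))\<^sup>2 \<le> (norm ?x + norm ?y)\<^sup>2"
        by (intro power_mono norm_triangle_ineq4) simp
      also have "\<dots> \<le> 2 * (a (fst w) + a (V (snd w)))"
        using sum_squares_bound[of "norm ?x" "norm ?y"] by (simp add: a_def power2_sum)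
      finally have "C * (norm (fst w - V (snd w)))\<^sup>2 \<le> C * (2 * (a (fst w) + a (V (snd w))))"
        using C(1) elim by (intro mult_left_mono) simp_all
      then show ?case
        using C(2)[of "fst w - V (snd w)"] by (simp add: algebra_simps)
    qed
  qed
  also have "\<dots> = 4 * C * (\<integral>u. a u \<partial>\<mu>)"
    using integrable_fst_marginal[OF coup ai] integrable_snd_marginal[OF coup aV(1)]
      integral_fst_marginal[OF coup am] integral_snd_marginal[OF coup, of "\<lambda>p. a (V p)"]
    by (simp add: aV(2))
  also have "\<dots> \<le> \<eta>"
    using s\<eta> C(1) by (simp add: a_def field_simps)
  finally show thesis
    using that[OF feas k] by blast
qed

subsection \<open>The limit of vanishing regularisation\<close>

lemma evqr_minimizers_weakly_tendsto:
  assumes opt: "\<And>\<epsilon>. \<epsilon> > 0 \<Longrightarrow> is_arg_min (evqr_objective \<epsilon> \<mu> \<nu>) (\<lambda>\<rho>. \<rho> \<in> evqr_feasible \<mu> \<nu>) (\<pi> \<epsilon>)"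
  shows "weakly_tendsto \<pi> \<pi>0 (at_right 0)"
proof (rule weakly_tendsto_pi0)
  have feas: "\<pi> \<epsilon> \<in> evqr_feasible \<mu> \<nu>" if "0 < \<epsilon>" for \<epsilon>
    using opt[OF that] by (simp add: is_arg_min_linorder)
  show "\<forall>\<^sub>F \<epsilon> in at_right 0. \<pi> \<epsilon> \<in> couplings \<mu> \<nu>"
    using eventually_at_right_less by eventually_elim (rule evqr_feasible_ortho(1)[OF feas])
  define I where "I \<rho> = (\<integral>w. q (fst w - V (snd w)) \<partial>\<rho>)" for \<rho>
  have I0: "0 \<le> I \<rho>" for \<rho>
    by (simp add: I_def integral_q_nonneg)
  have cost: "enn2ereal (\<integral>\<^sup>+(u, x, y). ennreal (1/2 * (norm (u - y))\<^sup>2) \<partial>\<rho>) = ereal (1/2 * (cost0 + I \<rho>))"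
    if "\<rho> \<in> evqr_feasible \<mu> \<nu>" for \<rho>
    using nn_cost_eq[OF evqr_feasible_ortho[OF that], of "1/2"] I0[of \<rho>] cost0_nonneg
    by (simp add: I_def enn2ereal_ennreal)
  show "((\<lambda>\<epsilon>. \<integral>w. q (fst w - V (snd w)) \<partial>\<pi> \<epsilon>) \<longlongrightarrow> 0) (at_right 0)"
  proof (rule tendstoI)
    fix e :: real assume e: "0 < e"
    obtain \<rho> k where r: "\<rho> \<in> evqr_feasible \<mu> \<nu>" and k: "KL \<rho> (\<mu> \<Otimes>\<^sub>M \<nu>) = ereal k"
      and small: "I \<rho> \<le> e / 2"
      using competitor[of "e / 2"] e unfolding I_def by auto
    define c where "c = \<bar>k\<bar> + 1"
    have c: "0 < c" "k \<le> c" by (auto simp: c_def)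
    define d where "d = e / (4 * c)"
    have d: "0 < d" using e c by (simp add: d_def)
    have "\<forall>\<^sub>F \<epsilon> in at_right (0::real). \<epsilon> < d"
      using d by (intro order_tendstoD(2)[OF tendsto_ident_at])
    with eventually_at_right_less[of "0::real"]
    show "\<forall>\<^sub>F \<epsilon> in at_right 0. dist (\<integral>w. q (fst w - V (snd w)) \<partial>\<pi> \<epsilon>) 0 < e"
    proof eventually_elim
      case (elim \<epsilon>)
      note f = feas[OF elim(1)]
      have "ereal (1/2 * (cost0 + I (\<pi> \<epsilon>))) \<le> evqr_objective \<epsilon> \<mu> \<nu> (\<pi> \<epsilon>)"
      proof -
        have "0 \<le> KL (\<pi> \<epsilon>) (\<mu> \<Otimes>\<^sub>M \<nu>)"
          by (rule KL_nonneg[OF mu_nu.prob_space_axioms])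
             (simp_all only: couplingsD[OF evqr_feasible_ortho(1)[OF f]] sets_mu_nu)
        then have "0 \<le> ereal \<epsilon> * KL (\<pi> \<epsilon>) (\<mu> \<Otimes>\<^sub>M \<nu>)"
          using elim(1) by simp
        then show ?thesis
          unfolding evqr_objective_def cost[OF f] by (metis add.right_neutral add_left_mono)
      qed
      also have "\<dots> \<le> evqr_objective \<epsilon> \<mu> \<nu> \<rho>"
        using opt[OF elim(1)] r by (simp add: is_arg_min_linorder)
      also have "\<dots> = ereal (1/2 * (cost0 + I \<rho>) + \<epsilon> * k)"
        unfolding evqr_objective_def cost[OF r] k by simp
      finally have "I (\<pi> \<epsilon>) \<le> I \<rho> + 2 * (\<epsilon> * k)"
        by (simp add: add_divide_distrib)
      moreover have "\<epsilon> * k < d * c"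
      proof -
        have "\<epsilon> * k \<le> \<epsilon> * c"
          using elim(1) c by (intro mult_left_mono) auto
        also have "\<dots> < d * c"
          using elim(2) c by (intro mult_strict_right_mono) auto
        finally show ?thesis .
      qed
      moreover have "d * c = e / 4"
        using c by (simp add: d_def)
      ultimately show ?case
        using small I0[of "\<pi> \<epsilon>"] e by (simp add: I_def)
    qed
  qed
qed

end

section \<open>The normal case\<close>

lemma gaussian_0_mat_1: "gaussian 0 (mat 1) = (std_gaussian :: (real^'n) measure)"
  using gaussian_matrix_factor[of 0 "mat 1 :: real^'n^'n"] by (simp add: transpose_mat distr_id2)

lemma integrable_std_gaussian: "integrable std_gaussian (\<lambda>z :: real^'n. z)"
  by (rule std_gaussian.integrable_of_integrable_norm_sq[OF _ integrable_norm_sq_std_gaussian]) simp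

lemma distr_std_gaussian_snd_split_vec:
  "distr std_gaussian borel (\<lambda>z :: real^('a::finite + 'b::finite). snd (split_vec z)) = std_gaussian"
proof -
  have "distr std_gaussian borel (\<lambda>z :: real^('a + 'b). snd (split_vec z))
      = distr (distr std_gaussian borel (split_vec :: real^('a + 'b) \<Rightarrow> _)) borel snd"
    by (subst distr_distr) (simp_all add: o_def borel_snd)
  also have "\<dots> = distr (std_gaussian \<Otimes>\<^sub>M std_gaussian :: ((real^'a) \<times> (real^'b)) measure) borel snd"
    by (simp add: distr_std_gaussian_split_vec)
  also have "\<dots> = std_gaussian"
  proof (rule measure_eqI)
    fix A :: "(real^'b) set" assume "A \<in> sets (distr (std_gaussian \<Otimes>\<^sub>M std_gaussian :: ((real^'a) \<times> (real^'b)) measure) borel snd)"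
    then have A: "A \<in> sets std_gaussian" by simp
    then have "emeasure (distr (std_gaussian \<Otimes>\<^sub>M std_gaussian :: ((real^'a) \<times> (real^'b)) measure) borel snd) A
      = emeasure (std_gaussian \<Otimes>\<^sub>M std_gaussian :: ((real^'a) \<times> (real^'b)) measure) (UNIV \<times> A)"
      by (subst emeasure_distr)
         (auto simp: space_pair_measure intro!: arg_cong[where f = "emeasure (std_gaussian \<Otimes>\<^sub>M std_gaussian)"])
    also have "\<dots> = emeasure std_gaussian A"
      using A std_gaussian.emeasure_space_1[where 'n = 'a]
      by (subst std_gaussian.emeasure_pair_measure_Times) simp_all
    finally show "emeasure (distr (std_gaussian \<Otimes>\<^sub>M std_gaussian :: ((real^'a) \<times> (real^'b)) measure) borel snd) A
      = emeasure std_gaussian A" .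
  qed simp
  finally show ?thesis .
qed

theorem proposition3p1:
  fixes m\<^sub>Y :: "real^'y"
    and \<Sigma>\<^sub>X\<^sub>X :: "real^'x^'x" and \<Sigma>\<^sub>X\<^sub>Y :: "real^'y^'x"
    and \<Sigma>\<^sub>Y\<^sub>X :: "real^'x^'y" and \<Sigma>\<^sub>Y\<^sub>Y :: "real^'y^'y"
    and \<Sigma> :: "real^('x + 'y)^('x + 'y)"
    and \<mu> :: "(real^'y) measure"
    and \<nu> :: "((real^'x) \<times> (real^'y)) measure"
    and \<pi> :: "real \<Rightarrow> ((real^'y) \<times> (real^'x) \<times> (real^'y)) measure"
    and m :: "real^('y + ('x + 'y))"
    and \<Lambda>\<^sub>o :: "real^'y^'y"
    and \<Gamma>\<^sub>o :: "real^('y + ('x + 'y))^('y + ('x + 'y))"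
    and \<pi>\<^sub>o :: "((real^'y) \<times> (real^'x) \<times> (real^'y)) measure"
  assumes "\<Sigma> = vcat (hcat \<Sigma>\<^sub>X\<^sub>X \<Sigma>\<^sub>X\<^sub>Y)
                    (hcat \<Sigma>\<^sub>Y\<^sub>X \<Sigma>\<^sub>Y\<^sub>Y)"
    and "psd \<Sigma>" and "invertible \<Sigma>"
    and "\<mu> = gaussian 0 (mat 1)"
    and "\<nu> = distr (gaussian (vcat 0 m\<^sub>Y) \<Sigma>) borel split_vec"
    and "\<And>\<epsilon>. \<epsilon> > 0 \<Longrightarrow> is_arg_min (evqr_objective \<epsilon> \<mu> \<nu>) (\<lambda>\<rho>. \<rho> \<in> evqr_feasible \<mu> \<nu>) (\<pi> \<epsilon>)"
    and "m = vcat 0 (vcat 0 m\<^sub>Y)"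
    and "\<Lambda>\<^sub>o = psd_sqrt (\<Sigma>\<^sub>Y\<^sub>Y - \<Sigma>\<^sub>Y\<^sub>X ** matrix_inv \<Sigma>\<^sub>X\<^sub>X ** \<Sigma>\<^sub>X\<^sub>Y)"
    and "\<Gamma>\<^sub>o = vcat (hcat (mat 1) (hcat 0 \<Lambda>\<^sub>o))
              (vcat (hcat 0 (hcat \<Sigma>\<^sub>X\<^sub>X \<Sigma>\<^sub>X\<^sub>Y))
                    (hcat \<Lambda>\<^sub>o (hcat \<Sigma>\<^sub>Y\<^sub>X \<Sigma>\<^sub>Y\<^sub>Y)))"
    and "\<pi>\<^sub>o = distr (gaussian m \<Gamma>\<^sub>o) borel (\<lambda>v. apsnd split_vec (split_vec v))"
  shows "weakly_tendsto \<pi> \<pi>\<^sub>o (at_right 0)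
    \<and> is_arg_min (\<lambda>\<rho>. \<integral>\<^sup>+(u, x, y). ennreal ((norm (u - y))\<^sup>2) \<partial>\<rho>) (\<lambda>\<rho>. \<rho> \<in> indep_feasible \<mu> \<nu>) \<pi>\<^sub>o
    \<and> (AE (u, x, y) in \<pi>\<^sub>o. y = m\<^sub>Y + \<Lambda>\<^sub>o *v u + (\<Sigma>\<^sub>Y\<^sub>X ** matrix_inv \<Sigma>\<^sub>X\<^sub>X) *v x)"
proof -
  note \<Sigma> = assms(1) and \<mu> = assms(4) and \<nu> = assms(5) and opt = assms(6)
    and m = assms(7) and \<Lambda>\<^sub>o = assms(8) and \<Gamma>\<^sub>o = assms(9) and \<pi>\<^sub>o = assms(10)
  define C where "C = \<Sigma>\<^sub>Y\<^sub>Y - \<Sigma>\<^sub>Y\<^sub>X ** matrix_inv \<Sigma>\<^sub>X\<^sub>X ** \<Sigma>\<^sub>X\<^sub>Y"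
  define A where "A = psd_sqrt \<Sigma>\<^sub>X\<^sub>X"
  define R where "R = \<Sigma>\<^sub>Y\<^sub>X ** matrix_inv \<Sigma>\<^sub>X\<^sub>X"
  define B where "B = vcat (hcat A 0) (hcat (R ** A) \<Lambda>\<^sub>o)"
  define M where "M = (hcat 0 (vcat (hcat 0 (mat 1)) B) :: real^('y + ('x + 'y))^('y + ('x + 'y)))"
  note schur = schur_complement[OF assms(2,3)[unfolded \<Sigma>], folded C_def]
  have A: "psd A" "A ** A = \<Sigma>\<^sub>X\<^sub>X"
    unfolding A_def using psd_sqrt[OF schur(2)] by auto
  have L: "psd \<Lambda>\<^sub>o" "\<Lambda>\<^sub>o ** \<Lambda>\<^sub>o = C"
    using psd_sqrt[OF schur(4)] by (auto simp: \<Lambda>\<^sub>o C_def)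
  have iL: "invertible \<Lambda>\<^sub>o"
    using schur(5) L(2) unfolding invertible_left_inverse
    by (metis matrix_mul_assoc)
  note inv = matrix_inv_inverse[OF schur(3)]
  \<comment> \<open>\<open>R\<close> is the matrix of regression coefficients of \<open>Y\<close> on \<open>X\<close>.\<close>
  have XR: "\<Sigma>\<^sub>X\<^sub>X ** transpose R = \<Sigma>\<^sub>X\<^sub>Y" and RX: "R ** \<Sigma>\<^sub>X\<^sub>X = \<Sigma>\<^sub>Y\<^sub>X"
  proof -
    show RX: "R ** \<Sigma>\<^sub>X\<^sub>X = \<Sigma>\<^sub>Y\<^sub>X"
      by (simp add: R_def inv flip: matrix_mul_assoc)
    have "\<Sigma>\<^sub>X\<^sub>X ** transpose R = transpose (R ** \<Sigma>\<^sub>X\<^sub>X)"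
      by (simp add: matrix_transpose_mul psdD(1)[OF schur(2)])
    then show "\<Sigma>\<^sub>X\<^sub>X ** transpose R = \<Sigma>\<^sub>X\<^sub>Y"
      unfolding RX schur(1)[symmetric] by simp
  qed
  have YY: "\<Sigma>\<^sub>Y\<^sub>X ** transpose R + \<Lambda>\<^sub>o ** \<Lambda>\<^sub>o = \<Sigma>\<^sub>Y\<^sub>Y"
  proof -
    have "\<Sigma>\<^sub>Y\<^sub>X ** transpose R = R ** \<Sigma>\<^sub>X\<^sub>Y"
      unfolding RX[symmetric] by (simp add: XR flip: matrix_mul_assoc)
    then show ?thesis
      by (simp add: L(2) C_def flip: R_def)
  qed
  note factor = block_factor[OF B_def M_def psdD(1)[OF A(1)] psdD(1)[OF L(1)],
      unfolded matrix_mul_assoc[symmetric, of R A A] A(2), unfolded XR RX, unfolded YY]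
  have \<mu>': "\<mu> = std_gaussian"
    by (simp add: \<mu> gaussian_0_mat_1)
  define P where "P = distr std_gaussian borel ((*v) A)"
  interpret linear_quantile_model \<mu> P m\<^sub>Y "(*v) R" "(*v) \<Lambda>\<^sub>o" "(*v) (matrix_inv \<Lambda>\<^sub>o)"
  proof (rule linear_quantile_model.intro)
    show "prob_space \<mu>" "sets \<mu> = sets borel" "integrable \<mu> (\<lambda>u. (norm u)\<^sup>2)"
      by (simp_all add: \<mu>' prob_space_std_gaussian integrable_norm_sq_std_gaussian)
    show "prob_space P"
      unfolding P_def by (rule std_gaussian.prob_space_distr) simp
    show "integrable P (\<lambda>x. (norm x)\<^sup>2)"
      using integrable_norm_sq_linear[of "\<lambda>z. z" std_gaussian "(*v) A"] integrable_norm_sq_std_gaussian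
      by (simp add: P_def integrable_distr_eq)
    show "(\<integral>x. x \<partial>P) = 0"
    proof -
      have "(\<integral>x. x \<partial>P) = (\<integral>z. A *v z \<partial>std_gaussian)"
        unfolding P_def by (simp add: integral_distr)
      also have "\<dots> = A *v (\<integral>z. z \<partial>std_gaussian)"
        by (intro integral_bounded_linear integrable_std_gaussian matrix_vector_mul_bounded_linear)
      finally show ?thesis by (simp add: integral_std_gaussian)
    qed
    show "\<Lambda>\<^sub>o *v (matrix_inv \<Lambda>\<^sub>o *v v) = v" "matrix_inv \<Lambda>\<^sub>o *v (\<Lambda>\<^sub>o *v v) = v" for v
      by (simp_all add: matrix_vector_mul_assoc matrix_inv_inverse[OF iL])
    show "(\<Lambda>\<^sub>o *v u) \<bullet> v = u \<bullet> (\<Lambda>\<^sub>o *v v)" for u v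
      by (simp add: psdD(3)[OF L(1)])
    show "0 < u \<bullet> (\<Lambda>\<^sub>o *v u)" if "u \<noteq> 0" for u
      by (rule psd_invertible_pos[OF L(1) iL that])
  qed (simp_all add: P_def)
  have Pmu: "P \<Otimes>\<^sub>M \<mu> = distr (std_gaussian \<Otimes>\<^sub>M std_gaussian) borel (\<lambda>(a, b). (A *v a, b))"
  proof -
    have "P \<Otimes>\<^sub>M \<mu> = distr std_gaussian borel ((*v) A) \<Otimes>\<^sub>M distr std_gaussian borel (\<lambda>b. b)"
      by (simp add: P_def \<mu>' distr_id2)
    also have "\<dots> = distr (std_gaussian \<Otimes>\<^sub>M std_gaussian) (borel \<Otimes>\<^sub>M borel) (\<lambda>(a, b). (A *v a, b))"
      by (rule pair_measure_distr)
        (simp_all add: distr_id2 prob_space_std_gaussian prob_space_imp_sigma_finite)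
    finally show ?thesis by (simp add: borel_prod)
  qed
  have law: "distr (P \<Otimes>\<^sub>M \<mu>) borel h = distr std_gaussian borel (\<lambda>z :: real^('x + 'y).
      h (A *v fst (split_vec z), snd (split_vec z)))"
    if [measurable]: "h \<in> borel_measurable borel" for h :: "(real^'x) \<times> (real^'y) \<Rightarrow> 'z::topological_space"
  proof -
    have [measurable]: "(\<lambda>(a, b). (A *v a, b)) \<in> borel_measurable (borel :: ((real^'x) \<times> (real^'y)) measure)"
      by (simp add: split_beta')
    have "distr (P \<Otimes>\<^sub>M \<mu>) borel h = distr (distr (distr std_gaussian borel split_vec) borel (\<lambda>(a, b). (A *v a, b))) borel h"
      by (simp add: Pmu distr_std_gaussian_split_vec)
    also have "\<dots> = distr std_gaussian borel (\<lambda>z :: real^('x + 'y).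
      h (A *v fst (split_vec z), snd (split_vec z)))"
      by (simp add: distr_distr o_def split_beta')
    finally show ?thesis .
  qed
  have Bz: "B *v z = vcat (A *v fst (split_vec z)) (R *v (A *v fst (split_vec z)) + \<Lambda>\<^sub>o *v snd (split_vec z))"
    for z :: "real^('x + 'y)"
    by (subst vcat_split_vec[of z, symmetric]) (simp add: B_def matrix_vector_mul_assoc del: vcat_split_vec)
  have nu: "linear_quantile_model.\<nu> \<mu> P m\<^sub>Y ((*v) R) ((*v) \<Lambda>\<^sub>o) = \<nu>"
  proof -
    have "\<nu> = distr std_gaussian borel (\<lambda>z. split_vec (vcat 0 m\<^sub>Y + B *v z))"
      unfolding \<nu> \<Sigma> factor(1)[symmetric] gaussian_matrix_factor by (simp add: distr_distr o_def)
    then show ?thesis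
      unfolding \<nu>_def by (simp add: law Bz algebra_simps)
  qed
  have Mz: "M *v z = vcat (snd (split_vec (snd (split_vec z)))) (B *v snd (split_vec z))" for z
  proof -
    obtain a b c where "z = vcat a (vcat b c)"
      by (metis vcat_split_vec)
    then show ?thesis by (simp add: M_def)
  qed
  have pi0: "\<pi>0 = \<pi>\<^sub>o"
  proof -
    have "\<pi>\<^sub>o = distr std_gaussian borel (\<lambda>z. apsnd split_vec (split_vec (m + M *v z)))"
      unfolding \<pi>\<^sub>o \<Gamma>\<^sub>o factor(2)[symmetric] gaussian_matrix_factor
      by (simp add: distr_distr o_def apsnd_def map_prod_def split_beta')
    also have "\<dots> = distr (distr std_gaussian borel (\<lambda>z :: real^('y + ('x + 'y)). snd (split_vec z))) borel (\<lambda>z :: real^('x + 'y).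
        (snd (split_vec z), A *v fst (split_vec z),
         m\<^sub>Y + R *v (A *v fst (split_vec z)) + \<Lambda>\<^sub>o *v snd (split_vec z)))"
      by (simp add: distr_distr o_def m Mz Bz algebra_simps)
    also have "\<dots> = \<pi>0"
      unfolding distr_std_gaussian_snd_split_vec pi0_eq by (simp add: law split_beta')
    finally show ?thesis ..
  qed
  have "weakly_tendsto \<pi> \<pi>\<^sub>o (at_right 0)"
    using evqr_minimizers_weakly_tendsto[unfolded nu pi0] opt by blast
  moreover have "is_arg_min (\<lambda>\<rho>. \<integral>\<^sup>+(u, x, y). ennreal ((norm (u - y))\<^sup>2) \<partial>\<rho>) (\<lambda>\<rho>. \<rho> \<in> indep_feasible \<mu> \<nu>) \<pi>\<^sub>o"
    using pi0_optimal unfolding nu pi0 .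
  moreover have "AE (u, x, y) in \<pi>\<^sub>o. y = m\<^sub>Y + \<Lambda>\<^sub>o *v u + (\<Sigma>\<^sub>Y\<^sub>X ** matrix_inv \<Sigma>\<^sub>X\<^sub>X) *v x"
    using AE_pi0 unfolding pi0
  proof eventually_elim
    case (elim w)
    show ?case
      using decompose[of "snd w"] elim by (simp add: split_beta' R_def[symmetric] add_ac)
  qed
  ultimately show ?thesis by blast
qed

end
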